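(* The quaternary quadratic form $Q_{15}^1=x^2+y^2+2z^2+8w^2+2zw$ (Gram matrix $\begin{pmatrix}1&0&0&0\\0&1&0&0\\0&0&2&1\\0&0&1&8\end{pmatrix}$) is primitively universal.
   Context: A quadratic form $f$ in variables $x,y,z,w$ is primitively universal if for every positive integer $n$ the equation $f(x,y,z,w)=n$ has an integer solution with $\gcd(x,y,z,w)=1$. *)

theory Defs
  imports Main
begin

definition primitively_universal :: "(int \<Rightarrow> int \<Rightarrow> int \<Rightarrow> int \<Rightarrow> int) \<Rightarrow> bool" where
  "primitively_universal f \<longleftrightarrow>
     (\<forall>n::int. n > 0 \<longrightarrow> (\<exists>x y z w. f x y z w = n \<and> Gcd {x, y, z, w} = 1))"

(* The Gram matrix has rows (1,0,0,0), (0,1,0,0), (0,0,2,1), (0,0,1,8); its two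
   off-diagonal entries 1 together give the cross term 2zw. *)
definition Q15_1 :: "int \<Rightarrow> int \<Rightarrow> int \<Rightarrow> int \<Rightarrow> int" where
  "Q15_1 x y z w = x^2 + y^2 + 2 * z^2 + 8 * w^2 + 2 * z * w"

end

theory Submission
  imports Defs "HOL-Number_Theory.Number_Theory" "HOL-Computational_Algebra.Squarefree"
begin

text \<open>
  Since $2Q = 2x^2 + 2y^2 + (2z+w)^2 + 15w^2$, the choices $w = 1$ for even $n$ and $w = 2$ for odd $n$
  make primitivity automatic and leave a sum of three squares $m = 2n - 15 \equiv 1 \pmod 4$ or
  $m = 2(n - 30) \equiv 2 \pmod 4$.

  For squarefree such $m$, let $q \equiv 1 \pmod 4$ be a prime with $-q$ a square modulo $m$ and $m$ a
  square modulo $q$. Then $m w^2 = z^2 + q u^2$ is solvable, hence $m$ is a sum of three rational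
  squares, as $q$ is one of two, and of three integral squares by Davenport--Cassels descent. The
  conditions on $q$ prescribe the values of finitely many independent real characters modulo $8m$,
  so only the real case of Dirichlet's theorem is needed: Mertens' estimate for
  $\sum \chi(n) \Lambda(n)/n$ together with $L(1,\chi) \neq 0$. Prime powers $q^k$ need no separate
  estimate: if some prescribed value is $-1$ then $k$ is odd, and if all are $1$ then $q = 1$ serves.
\<close>

section \<open>Chebyshev's bound and divisor sums\<close>

text \<open>The choice of w is forced by m = 2n - 15 w^2 modulo 4: with w = 1 an odd n would give m
  = 3 mod 4, and such an m may be 7 mod 8, hence no sum of three squares. In the two classes that
  remain, reciprocity makes the conditions on q compatible. They ask only for signs of real
  characters, never for a residue class of q, so no complex character enters. The analytic part
  works with sums up to X instead of Dirichlet series; limits occur only in the treatment of L(1,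
  \<chi>), where the real values of \<chi> give the positivity that excludes L = 0.\<close>

lemma abel_summation_bound:
  fixes a b :: "nat \<Rightarrow> real"
  assumes C: "\<And>k. \<bar>\<Sum>n<k. a n\<bar> \<le> C"
    and decr: "\<And>n. M \<le> n \<Longrightarrow> b (Suc n) \<le> b n"
    and nonneg: "\<And>n. M \<le> n \<Longrightarrow> 0 \<le> b n"
  shows "\<bar>\<Sum>n=M..<X. a n * b n\<bar> \<le> 2 * C * b M"
proof -
  have C0: "C \<ge> 0" using C[of 0] by simp
  define A where "A = (\<lambda>k. \<Sum>n<k. a n)"
  show ?thesis
  proof (cases "M \<le> X")
    case False
    then show ?thesis using C0 nonneg[of M] by simp
  next
    case True
    \<comment> \<open>The bound is \<open>C * b M\<close> for the boundary term at \<open>M\<close>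
      plus \<open>C * (b M - b X)\<close> from the telescoping differences; the boundary term at
      \<open>X\<close> adds \<open>C * b X\<close> and completes \<open>2 * C * b M\<close>.\<close>
    then have "\<bar>(\<Sum>n=M..<X. a n * b n) - A X * b X\<bar> \<le> C * (2 * b M - b X)"
    proof (induction X rule: dec_induct)
      case base
      have "\<bar>A M\<bar> * b M \<le> C * b M"
        using C[of M] nonneg[of M] unfolding A_def by (intro mult_right_mono) auto
      then show ?case using nonneg[of M] by (simp add: abs_mult algebra_simps)
    next
      case (step n)
      have "\<bar>A (Suc n)\<bar> * (b n - b (Suc n)) \<le> C * (b n - b (Suc n))"
        using C[of "Suc n"] decr[of n] step unfolding A_def by (intro mult_right_mono) auto
      then have "\<bar>A (Suc n) * (b n - b (Suc n))\<bar> \<le> C * (b n - b (Suc n))"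
        using decr[of n] step by (simp add: abs_mult)
      moreover have "(\<Sum>n=M..<Suc n. a n * b n) - A (Suc n) * b (Suc n)
          = ((\<Sum>n=M..<n. a n * b n) - A n * b n) + A (Suc n) * (b n - b (Suc n))"
        using step by (simp add: A_def algebra_simps)
      ultimately show ?case using step.IH by (simp add: algebra_simps)
    qed
    moreover have "\<bar>A X * b X\<bar> \<le> C * b X"
      using C[of X] nonneg[of X] True unfolding A_def
      by (simp add: abs_mult mult_right_mono)
    ultimately show ?thesis by (simp add: algebra_simps)
  qed
qed

text \<open>Both sides run over the pairs (d, k) with d k <= X. This interchange unfolds every
  Dirichlet convolution below.\<close>

lemma sum_divisors_swap:
  fixes g :: "nat \<Rightarrow> nat \<Rightarrow> real"
  shows "(\<Sum>n=1..X. \<Sum>d | d dvd n. g d (n div d)) = (\<Sum>d=1..X. \<Sum>k=1..X div d. g d k)"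
proof -
  have "(\<Sum>n=1..X. \<Sum>d | d dvd n. g d (n div d))
      = (\<Sum>(n, d)\<in>Sigma {1..X} (\<lambda>n. {d. d dvd n}). g d (n div d))"
    by (intro sum.Sigma) auto
  also have "\<dots> = (\<Sum>(d, k)\<in>Sigma {1..X} (\<lambda>d. {1..X div d}). g d k)"
  proof (rule sum.reindex_bij_witness[where i = "\<lambda>(d, k). (d * k, d)" and j = "\<lambda>(n, d). (d, n div d)"])
    fix p assume "p \<in> Sigma {1..X} (\<lambda>n. {d. d dvd n})"
    then obtain n d where p: "p = (n, d)" "1 \<le> n" "n \<le> X" "d dvd n" by auto
    then have "d \<le> n" "d \<ge> 1" "n div d \<ge> 1" "n div d \<le> X div d"
      by (auto simp: dvd_imp_le div_greater_zero_iff Suc_le_eq div_le_mono dvd_pos_nat)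
    then show "(case p of (n, d) \<Rightarrow> (d, n div d)) \<in> Sigma {1..X} (\<lambda>d. {1..X div d})"
      using p by auto
  next
    fix p assume "p \<in> Sigma {1..X} (\<lambda>d. {1..X div d})"
    then obtain d k where p: "p = (d, k)" "1 \<le> d" "1 \<le> k" "k \<le> X div d" by auto
    then have "d * k \<le> d * (X div d)" by simp
    also have "\<dots> \<le> X" by simp
    finally show "(case p of (d, k) \<Rightarrow> (d * k, d)) \<in> Sigma {1..X} (\<lambda>n. {d. d dvd n})"
      using p by auto
  qed auto
  also have "\<dots> = (\<Sum>d=1..X. \<Sum>k=1..X div d. g d k)"
    by (intro sum.Sigma[symmetric]) auto
  finally show ?thesis .
qed

lemma sum_ln_eq_mangoldt:
  "(\<Sum>n=1..X. ln (real n)) = (\<Sum>d=1..X. mangoldt d * real (X div d))"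
proof -
  have "(\<Sum>n=1..X. ln (real n)) = (\<Sum>n=1..X. \<Sum>d | d dvd n. mangoldt d)"
    by (intro sum.cong refl) (simp add: mangoldt_sum)
  also have "\<dots> = (\<Sum>d=1..X. \<Sum>k=1..X div d. mangoldt d)"
    by (rule sum_divisors_swap)
  finally show ?thesis by (simp add: mult.commute)
qed

lemma sum_ln_eq_ln_fact: "(\<Sum>n=1..X. ln (real n)) = ln (fact X)"
  by (induction X) (simp_all add: ln_mult del: of_nat_Suc)

text \<open>The logarithm of binomial(2n, n) is the sum of \<open>mangoldt d\<close> times
  floor(2n/d) - 2 floor(n/d). This factor is never negative and is at least 1 for n < d <= 2n, while
  the binomial is at most 4^n.\<close>

lemma chebyshev_doubling:
  "(\<Sum>d=1..2*n. mangoldt d) \<le> (\<Sum>d=1..n. mangoldt d) + real n * ln 4"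
proof -
  have le: "2 * (n div d) \<le> (2 * n) div d" for d
    by (metis add_leD1 div_add1_eq mult_2 le_add1)
  have "(\<Sum>d=1..2*n. mangoldt d) - (\<Sum>d=1..n. mangoldt d) = (\<Sum>d\<in>{1..2*n} - {1..n}. mangoldt d :: real)"
    by (subst sum_diff) auto
  also have "\<dots> \<le> (\<Sum>d\<in>{1..2*n} - {1..n}. mangoldt d * (real ((2 * n) div d) - 2 * real (n div d)))"
  proof (rule sum_mono)
    fix d assume d: "d \<in> {1..2*n} - {1..n}"
    then have "n div d = 0" "(2 * n) div d \<ge> 1" by (auto simp: div_greater_zero_iff Suc_le_eq)
    then have "(1::real) \<le> real ((2 * n) div d) - 2 * real (n div d)" by simp
    from mult_left_mono[OF this mangoldt_nonneg[of d]]
    show "mangoldt d \<le> mangoldt d * (real ((2 * n) div d) - 2 * real (n div d))" by simp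
  qed
  also have "\<dots> \<le> (\<Sum>d=1..2*n. mangoldt d * (real ((2 * n) div d) - 2 * real (n div d)))"
  proof (rule sum_mono2)
    fix d
    have "real (2 * (n div d)) \<le> real ((2 * n) div d)" using le[of d] by (rule of_nat_mono)
    then show "0 \<le> mangoldt d * (real ((2 * n) div d) - 2 * real (n div d))"
      by (intro mult_nonneg_nonneg mangoldt_nonneg) simp
  qed auto
  also have "\<dots> = (\<Sum>d=1..2*n. mangoldt d * real ((2 * n) div d))
      - 2 * (\<Sum>d=1..2*n. mangoldt d * real (n div d))"
    by (simp add: sum_subtractf sum_distrib_left algebra_simps)
  also have "(\<Sum>d=1..2*n. mangoldt d * real (n div d)) = (\<Sum>d=1..n. mangoldt d * real (n div d))"
    by (intro sum.mono_neutral_right) auto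
  also have "(\<Sum>d=1..2*n. mangoldt d * real ((2 * n) div d)) - 2 * (\<Sum>d=1..n. mangoldt d * real (n div d))
      = ln (fact (2 * n)) - 2 * ln (fact n)"
    by (simp only: sum_ln_eq_mangoldt[symmetric] sum_ln_eq_ln_fact)
  also have "\<dots> \<le> real n * ln 4"
  proof -
    have "(fact (2 * n) :: real) = fact n * fact n * real (2 * n choose n)"
      by (simp add: binomial_fact)
    also have "\<dots> \<le> fact n * fact n * 4 ^ n"
    proof (intro mult_left_mono)
      have "real (2 * n choose n) \<le> real (2 ^ (2 * n))"
        by (rule of_nat_mono) (rule binomial_le_pow2)
      then show "real (2 * n choose n) \<le> 4 ^ n" by (simp add: power_mult)
    qed auto
    finally have "ln (fact (2 * n) :: real) \<le> ln (fact n * fact n * 4 ^ n)"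
      by simp
    then show ?thesis by (simp add: ln_mult ln_realpow)
  qed
  finally show ?thesis by simp
qed

lemma chebyshev_upper_bound: "(\<Sum>d=1..X. mangoldt d) \<le> 3 * ln 4 * real X"
proof (induction X rule: less_induct)
  case (less X)
  show ?case
  proof (cases "X \<le> 1")
    case True
    then have "X = 0 \<or> X = 1" by auto
    then show ?thesis by auto
  next
    case False
    define n where "n = (X + 1) div 2"
    have n: "X \<le> 2 * n" "2 * n \<le> X + 1" "n < X" using False unfolding n_def by auto
    have "(\<Sum>d=1..X. mangoldt d) \<le> (\<Sum>d=1..2*n. mangoldt d :: real)"
      using n by (intro sum_mono2) (auto simp: mangoldt_nonneg)
    also have "\<dots> \<le> (\<Sum>d=1..n. mangoldt d) + real n * ln 4" by (rule chebyshev_doubling)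
    also have "\<dots> \<le> 3 * ln 4 * real n + real n * ln 4" using less.IH[OF n(3)] by (rule add_right_mono)
    also have "\<dots> = ln 4 * (4 * real n)" by simp
    \<comment> \<open>Halving rounds up, so 4n <= 2X + 2 <= 3X because X >= 2; hence the constant
      3.\<close>
    also have "\<dots> \<le> ln 4 * (3 * real X)" using n False by (intro mult_left_mono) auto
    finally show ?thesis by simp
  qed
qed

section \<open>Divisor sums of completely multiplicative functions\<close>

lemma sum_divisors_coprime_mult:
  fixes f :: "nat \<Rightarrow> real"
  assumes cop: "coprime a b" and mult: "\<And>m n. f (m * n) = f m * f n"
  shows "(\<Sum>d | d dvd a * b. f d) = (\<Sum>d | d dvd a. f d) * (\<Sum>d | d dvd b. f d)"
proof -
  have "bij_betw (\<lambda>(x, y). x * y) ({d. d dvd a} \<times> {d. d dvd b}) {d. d dvd a * b}"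
  proof (intro bij_betw_imageI inj_onI)
    have gcds: "gcd (x * y) a = x" "gcd (x * y) b = y" if "x dvd a" "y dvd b" for x y
    proof -
      have "coprime a y" "coprime b x"
        using coprime_divisors[OF dvd_refl that(2) cop] coprime_divisors[OF that(1) dvd_refl cop]
        by (simp_all add: coprime_commute)
      then show "gcd (x * y) a = x" "gcd (x * y) b = y"
        using that by (simp_all add: gcd_mult_left_left_cancel gcd_mult_left_right_cancel gcd_nat.absorb1)
    qed
    fix p p' assume p: "p \<in> {d. d dvd a} \<times> {d. d dvd b}" "p' \<in> {d. d dvd a} \<times> {d. d dvd b}"
      and eq: "(case p of (x, y) \<Rightarrow> x * y) = (case p' of (x, y) \<Rightarrow> x * y)"
    obtain x y x' y' where xy: "p = (x, y)" "p' = (x', y')" by fastforce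
    with p have dvds: "x dvd a" "y dvd b" "x' dvd a" "y' dvd b" by auto
    from eq xy have "x * y = x' * y'" by simp
    with gcds[OF dvds(1,2)] gcds[OF dvds(3,4)] xy show "p = p'" by simp
  next
    show "(\<lambda>(x, y). x * y) ` ({d. d dvd a} \<times> {d. d dvd b}) = {d. d dvd a * b}"
    proof (intro equalityI subsetI)
      fix d assume "d \<in> {d. d dvd a * b}"
      then obtain x y where "d = x * y" "x dvd a" "y dvd b" using division_decomp by blast
      then show "d \<in> (\<lambda>(x, y). x * y) ` ({d. d dvd a} \<times> {d. d dvd b})" by force
    qed (auto intro: mult_dvd_mono)
  qed
  from sum.reindex_bij_betw[OF this, of f]
  have "(\<Sum>d | d dvd a * b. f d) = (\<Sum>(x, y)\<in>{d. d dvd a} \<times> {d. d dvd b}. f x * f y)"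
    by (simp add: mult case_prod_unfold)
  also have "\<dots> = (\<Sum>d | d dvd a. f d) * (\<Sum>d | d dvd b. f d)"
    by (simp add: sum_product sum.cartesian_product)
  finally show ?thesis .
qed

lemma sum_divisors_prime_power:
  fixes f :: "nat \<Rightarrow> real"
  assumes "prime p" "\<And>m n. f (m * n) = f m * f n" "f 1 = 1"
  shows "(\<Sum>d | d dvd p ^ k. f d) = (\<Sum>i\<le>k. f p ^ i)"
proof -
  have pow: "f (p ^ i) = f p ^ i" for i by (induction i) (use assms in auto)
  have "{d. d dvd p ^ k} = (\<lambda>i. p ^ i) ` {..k}"
    using assms(1) by (auto simp: divides_primepow_nat)
  moreover have "inj_on (\<lambda>i. p ^ i) {..k}"
    using prime_gt_1_nat[OF assms(1)] by (auto simp: inj_on_def)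
  ultimately show ?thesis by (simp add: sum.reindex pow)
qed

text \<open>Local factors at a prime of the divisor sums below. For x = -1 the alternating sum ends
  on 1 at an even exponent and on 0 at an odd one.\<close>

lemma geometric_sum_sign:
  fixes x :: real
  assumes "x = 0 \<or> x = 1 \<or> x = -1"
  shows "0 \<le> (\<Sum>i\<le>k. x ^ i)" "even k \<Longrightarrow> 1 \<le> (\<Sum>i\<le>k. x ^ i)"
proof -
  have "(\<Sum>i\<le>k. x ^ i) = (if x = 0 then 1 else if x = 1 then real k + 1 else if even k then 1 else 0)"
    using assms by (induction k) auto
  then show "0 \<le> (\<Sum>i\<le>k. x ^ i)" "even k \<Longrightarrow> 1 \<le> (\<Sum>i\<le>k. x ^ i)" by auto
qed

lemma prime_power_split:
  fixes n :: nat
  assumes "n > 1"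
  obtains p k m where "prime p" "k > 0" "n = p ^ k * m" "coprime p m" "m < n" "m > 0"
proof -
  obtain p where p: "prime p" "p dvd n" using prime_factor_nat[of n] assms by auto
  obtain m where m: "n = p ^ multiplicity p n * m" "\<not> p dvd m"
    using multiplicity_decompose'[of n p] p assms by (metis not_prime_unit not_one_less_zero)
  have k: "multiplicity p n > 0" using p assms by (simp add: prime_multiplicity_gt_zero_iff)
  have m0: "m > 0" using m(2) by (cases m) auto
  have "1 < p ^ multiplicity p n" by (rule one_less_power[OF prime_gt_1_nat[OF p(1)] k])
  then have "1 * m < p ^ multiplicity p n * m" using m0 by (intro mult_strict_right_mono)
  then have "m < n" using m(1) by simp
  with p(1) k m m0 show ?thesis using that prime_imp_coprime by blast
qed

text \<open>For a real character these sums are the coefficients of its Lambert series. Their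
  nonnegativity, with the lower bound 1 at squares, makes the series unbounded as t tends to 1,
  which later contradicts \<open>L = 0\<close>.\<close>

lemma sum_divisors_nonneg:
  fixes f :: "nat \<Rightarrow> real"
  assumes mult: "\<And>m n. f (m * n) = f m * f n" and one: "f 1 = 1"
    and vals: "\<And>n. f n = 0 \<or> f n = 1 \<or> f n = -1" and "n > 0"
  shows "0 \<le> (\<Sum>d | d dvd n. f d)"
  using \<open>n > 0\<close>
proof (induction n rule: less_induct)
  case (less n)
  show ?case
  proof (cases "n = 1")
    case True
    then show ?thesis using one by simp
  next
    case False
    then have "n > 1" using less.prems by simp
    then obtain p k m where *: "prime p" "k > 0" "n = p ^ k * m" "coprime p m" "m < n" "m > 0"
      by (rule prime_power_split)
    then have "(\<Sum>d | d dvd n. f d) = (\<Sum>i\<le>k. f p ^ i) * (\<Sum>d | d dvd m. f d)"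
      using sum_divisors_coprime_mult[of "p ^ k" m f] sum_divisors_prime_power[of p f k] mult one
      by (simp add: prime_gt_0_nat)
    then show ?thesis using geometric_sum_sign(1)[OF vals] less.IH[of m] * by simp
  qed
qed

text \<open>In a square every prime occurs to an even power, so every local factor is at least
  1.\<close>

lemma sum_divisors_square_ge_1:
  fixes f :: "nat \<Rightarrow> real"
  assumes mult: "\<And>m n. f (m * n) = f m * f n" and one: "f 1 = 1"
    and vals: "\<And>n. f n = 0 \<or> f n = 1 \<or> f n = -1" and "n > 0"
  shows "1 \<le> (\<Sum>d | d dvd n^2. f d)"
  using \<open>n > 0\<close>
proof (induction n rule: less_induct)
  case (less n)
  show ?case
  proof (cases "n = 1")
    case True
    then show ?thesis using one by simp
  next
    case False
    then have "n > 1" using less.prems by simp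
    then obtain p k m where *: "prime p" "k > 0" "n = p ^ k * m" "coprime p m" "m < n" "m > 0"
      by (rule prime_power_split)
    have "n^2 = p ^ (2 * k) * m^2" using *(3) by (simp add: power_mult_distrib power_mult [symmetric] mult.commute)
    then have "(\<Sum>d | d dvd n^2. f d) = (\<Sum>i\<le>2*k. f p ^ i) * (\<Sum>d | d dvd m^2. f d)"
      using sum_divisors_coprime_mult[of "p ^ (2 * k)" "m^2" f] sum_divisors_prime_power[of p f "2 * k"] mult one *
      by (simp add: prime_gt_0_nat)
    moreover have "1 * 1 \<le> (\<Sum>i\<le>2*k. f p ^ i) * (\<Sum>d | d dvd m^2. f d)"
      using geometric_sum_sign[OF vals[of p], of "2 * k"] less.IH[of m] * by (intro mult_mono) auto
    ultimately show ?thesis by simp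
  qed
qed

section \<open>Real characters\<close>

locale real_character =
  fixes N :: nat and \<chi> :: "nat \<Rightarrow> real"
  assumes N_pos: "N > 0"
    and not_coprime: "\<not> coprime n N \<Longrightarrow> \<chi> n = 0"
    and coprime: "coprime n N \<Longrightarrow> \<chi> n = 1 \<or> \<chi> n = -1"
    and mult: "\<chi> (m * n) = \<chi> m * \<chi> n"
    and periodic: "\<chi> (n + N) = \<chi> n"
begin

lemma trichotomy: "\<chi> n = 0 \<or> \<chi> n = 1 \<or> \<chi> n = -1"
  using not_coprime coprime by blast

lemma abs_le_1: "\<bar>\<chi> n\<bar> \<le> 1"
  using trichotomy[of n] by auto

lemma one: "\<chi> 1 = 1"
  using coprime[of 1] mult[of 1 1] by auto

lemma mod: "\<chi> (n mod N) = \<chi> n"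
proof -
  have "\<chi> (r + k * N) = \<chi> r" for r k
  proof (induction k)
    case (Suc k)
    have "\<chi> (r + Suc k * N) = \<chi> ((r + k * N) + N)" by (simp add: algebra_simps)
    then show ?case using periodic Suc.IH by simp
  qed simp
  from this[of "n mod N" "n div N"] show ?thesis by simp
qed

end

locale nonprincipal_character = real_character +
  assumes nonprincipal: "\<exists>a. \<chi> a = -1"
begin

text \<open>Multiplication by a unit \<open>a\<close> with \<open>\<chi> a = -1\<close> permutes the
  residues and negates the sum.\<close>

lemma sum_period: "(\<Sum>n<N. \<chi> n) = 0"
proof -
  obtain a where a: "\<chi> a = -1" using nonprincipal by blast
  then have cop: "coprime a N" using not_coprime by fastforce
  have "inj_on (\<lambda>n. a * n mod N) {..<N}"
  proof (rule inj_onI)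
    fix x y assume "x \<in> {..<N}" "y \<in> {..<N}" "a * x mod N = a * y mod N"
    then show "x = y"
      using cong_mult_lcancel_nat[OF cop, of x y] by (auto simp: cong_def)
  qed
  moreover have "(\<lambda>n. a * n mod N) ` {..<N} \<subseteq> {..<N}"
    using N_pos by auto
  ultimately have "bij_betw (\<lambda>n. a * n mod N) {..<N} {..<N}"
    by (simp add: bij_betw_def endo_inj_surj)
  from sum.reindex_bij_betw[OF this, of \<chi>]
  have "(\<Sum>n<N. \<chi> (a * n)) = (\<Sum>n<N. \<chi> n)" by (simp add: mod)
  then show ?thesis by (simp add: mult a sum_negf)
qed

lemma partial_sum_bound: "\<bar>\<Sum>n<k. \<chi> n\<bar> \<le> real N"
proof (induction k rule: less_induct)
  case (less k)
  show ?case
  proof (cases "k \<le> N")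
    case True
    have "\<bar>\<Sum>n<k. \<chi> n\<bar> \<le> (\<Sum>n<k. \<bar>\<chi> n\<bar>)" by (rule sum_abs)
    also have "\<dots> \<le> (\<Sum>n<k. 1)" by (intro sum_mono abs_le_1)
    finally show ?thesis using True by simp
  next
    case False
    define j where "j = k - N"
    have k: "k = j + N" "j < k" using False N_pos unfolding j_def by auto
    have "(\<Sum>n<j + N. \<chi> n) = (\<Sum>n<N. \<chi> n) + (\<Sum>n<j. \<chi> n)"
      by (induction j) (simp_all add: periodic)
    then show ?thesis using less.IH[OF k(2)] k(1) sum_period by simp
  qed
qed

lemma weighted_sum_bound:
  assumes "\<And>n. M \<le> n \<Longrightarrow> b (Suc n) \<le> b n" "\<And>n. M \<le> n \<Longrightarrow> 0 \<le> b n"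
  shows "\<bar>\<Sum>n=M..X. \<chi> n * b n\<bar> \<le> 2 * real N * b M"
  using abel_summation_bound[OF partial_sum_bound, of M b "Suc X"] assms
  by (simp only: atLeastLessThanSuc_atLeastAtMost)

definition partial_L where
  "partial_L X = (\<Sum>n=1..X. \<chi> n / real n)"

text \<open>L(1, \<chi>), given by a series in its natural order; \<open>lim\<close> has this
  meaning only by \<open>partial_L_tendsto\<close>.\<close>

definition L where
  "L = lim partial_L"

lemma partial_L_diff:
  assumes "m \<ge> k"
  shows "\<bar>partial_L m - partial_L k\<bar> \<le> 2 * real N / real (Suc k)"
proof -
  have "partial_L m = partial_L k + (\<Sum>n=Suc k..m. \<chi> n * (1 / real n))"
  proof -
    have "{1..m} = {1..k} \<union> {Suc k..m}" using assms by auto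
    then show ?thesis unfolding partial_L_def by (simp add: sum.union_disjoint)
  qed
  moreover have "\<bar>\<Sum>n=Suc k..m. \<chi> n * (1 / real n)\<bar> \<le> 2 * real N * (1 / real (Suc k))"
    by (intro weighted_sum_bound) (auto simp: frac_le)
  ultimately show ?thesis by simp
qed

lemma partial_L_tendsto: "partial_L \<longlonglongrightarrow> L"
proof -
  have "Cauchy partial_L"
  proof (rule CauchyI')
    fix e :: real assume e: "e > 0"
    obtain M where M: "2 * real N / e < real M" using reals_Archimedean2 by blast
    have "\<bar>partial_L k - partial_L m\<bar> < e" if "M \<le> k" "k < m" for k m
    proof -
      have "2 * real N < e * real M" using M e by (simp add: field_simps)
      also have "\<dots> \<le> e * real (Suc k)" using that e by (intro mult_left_mono) auto
      finally have "2 * real N / real (Suc k) < e" by (simp add: field_simps)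
      then show ?thesis using partial_L_diff[of k m] that by (simp add: abs_minus_commute)
    qed
    then show "\<exists>M. \<forall>m\<ge>M. \<forall>n>m. dist (partial_L m) (partial_L n) < e"
      unfolding dist_real_def by auto
  qed
  then show ?thesis unfolding L_def by (simp add: Cauchy_convergent_iff convergent_LIMSEQ_iff)
qed

text \<open>The explicit rate matters: at k = X div d it bounds the error by a multiple of d / X,
  and Chebyshev's bound then sums these errors weighted by
  \<open>mangoldt d / real d\<close>.\<close>

lemma L_tail: "\<bar>L - partial_L k\<bar> \<le> 2 * real N / real (Suc k)"
proof (rule LIMSEQ_le_const2)
  show "(\<lambda>m. \<bar>partial_L m - partial_L k\<bar>) \<longlonglongrightarrow> \<bar>L - partial_L k\<bar>"
    by (intro tendsto_intros partial_L_tendsto)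
  show "\<exists>M. \<forall>m\<ge>M. \<bar>partial_L m - partial_L k\<bar> \<le> 2 * real N / real (Suc k)"
    using partial_L_diff by blast
qed

end

section \<open>Nonvanishing of L(1, chi)\<close>

text \<open>AM-GM on the terms with indices i and n - 1 - i, whose product is u^(2(n-1)) for every
  i.\<close>

lemma geometric_sum_ge:
  fixes u :: real
  assumes "0 < u" "u < 1"
  shows "real n * u ^ (n - 1) \<le> (\<Sum>i<n. (u^2) ^ i)"
proof -
  have "2 * (real n * u ^ (n - 1)) = (\<Sum>i<n. 2 * u ^ (n - 1))" by simp
  also have "\<dots> \<le> (\<Sum>i<n. (u^2) ^ i + (u^2) ^ (n - Suc i))"
  proof (rule sum_mono)
    fix i assume "i \<in> {..<n}"
    then have "u ^ (n - 1) = u ^ i * u ^ (n - Suc i)" by (simp add: power_add[symmetric])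
    then show "2 * u ^ (n - 1) \<le> (u^2) ^ i + (u^2) ^ (n - Suc i)"
      using sum_squares_bound[of "u ^ i" "u ^ (n - Suc i)"] by (simp add: power_mult[symmetric] mult_ac)
  qed
  also have "\<dots> = 2 * (\<Sum>i<n. (u^2) ^ i)"
    by (simp add: sum.distrib sum.nat_diff_reindex[of "\<lambda>i. (u^2) ^ i"])
  finally show ?thesis by simp
qed

text \<open>
  The weights of Monsky's proof that $L(1,\chi) \neq 0$: if $\sum \chi(n)/n = 0$, then the Lambert
  series of $\chi$ equals $-\sum \chi(n) b_n$, and $b_n$ decreases, so the series stays bounded as $t \to 1$.
\<close>

definition monsky_weight :: "real \<Rightarrow> nat \<Rightarrow> real" where
  "monsky_weight t n = 1 / (real n * (1 - t)) - t ^ n / (1 - t ^ n)"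

text \<open>Equivalent to n t^n <= 1 + t + ... + t^(n-1), where no term on the right is below
  t^n.\<close>

lemma monsky_weight_nonneg:
  assumes "0 < t" "t < 1" "1 \<le> n"
  shows "0 \<le> monsky_weight t n"
proof -
  have "real n * t ^ n = (\<Sum>i<n. t ^ n)" by simp
  also have "\<dots> \<le> (\<Sum>i<n. t ^ i)" using assms by (intro sum_mono power_decreasing) auto
  also have "\<dots> = (1 - t ^ n) / (1 - t)" using assms by (simp add: sum_gp_strict)
  finally have "real n * t ^ n * (1 - t) \<le> 1 - t ^ n" using assms by (simp add: field_simps)
  moreover have "t ^ n < 1" using assms by (simp add: power_less_one_iff)
  ultimately have "t ^ n / (1 - t ^ n) \<le> 1 / (real n * (1 - t))"
    using assms by (simp add: pos_divide_le_eq pos_le_divide_eq mult_ac)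
  then show ?thesis unfolding monsky_weight_def by simp
qed

text \<open>With s_k = 1 + ... + t^(k-1) the claim reduces to n (n+1) t^n <= s_n s_(n+1), which
  follows from AM-GM in both factors.\<close>

lemma monsky_weight_decreasing:
  assumes "0 < t" "t < 1" "1 \<le> n"
  shows "monsky_weight t (Suc n) \<le> monsky_weight t n"
proof -
  \<comment> \<open>AM-GM bounds s_n below by n t^((n-1)/2); the square root keeps exponents
    integral. The two bounds together carry u^(2n-1), which is at least u^(2n) = t^n.\<close>
  define u where "u = sqrt t"
  have u: "0 < u" "u < 1" "t = u^2" using assms unfolding u_def by auto
  define s where "s = (\<lambda>k. \<Sum>i<k. t ^ i)"
  have s: "1 - t ^ k = (1 - t) * s k" for k using assms unfolding s_def by (simp add: sum_gp_strict)
  have spos: "s k > 0" if "k \<ge> 1" for k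
    unfolding s_def using assms that by (intro sum_pos) (auto simp: lessThan_empty_iff)
  have "real n * real (Suc n) * t ^ n \<le> real n * real (Suc n) * u ^ (2 * n - 1)"
    using u by (intro mult_left_mono) (auto simp: power_mult[symmetric] intro: power_decreasing)
  also have "\<dots> = (real n * u ^ (n - 1)) * (real (Suc n) * u ^ n)"
  proof -
    have "2 * n - 1 = (n - 1) + n" by simp
    then show ?thesis by (simp only: power_add mult_ac)
  qed
  also have "\<dots> \<le> s n * s (Suc n)"
    using geometric_sum_ge[OF u(1,2), of n] geometric_sum_ge[OF u(1,2), of "Suc n"] u spos[of n] assms
    unfolding s_def u(3)[symmetric] by (intro mult_mono) auto
  finally have key: "real n * real (Suc n) * t ^ n \<le> s n * s (Suc n)" .
  have "t ^ n / (1 - t ^ n) - t ^ Suc n / (1 - t ^ Suc n) = t ^ n * (1 - t) / ((1 - t ^ n) * (1 - t ^ Suc n))"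
  proof -
    have "0 < (1 - t) * s n" "0 < (1 - t) * s (Suc n)"
      using spos[of n] spos[of "Suc n"] assms by auto
    then have "t ^ n < 1" "t * t ^ n < 1"
      unfolding s[symmetric] by simp_all
    then show ?thesis by (simp add: divide_simps) (simp add: algebra_simps)
  qed
  also have "\<dots> = t ^ n / ((1 - t) * (s n * s (Suc n)))"
    unfolding s using assms spos[of n] spos[of "Suc n"] by (simp add: divide_simps)
  also have "\<dots> \<le> 1 / (real n * real (Suc n) * (1 - t))"
    using key assms spos[of n] spos[of "Suc n"]
    by (simp add: divide_simps mult_ac)
  also have "\<dots> = 1 / (real n * (1 - t)) - 1 / (real (Suc n) * (1 - t))"
    using assms by (simp add: divide_simps)
  finally show ?thesis unfolding monsky_weight_def by simp
qed

context nonprincipal_character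
begin

text \<open>Truncation at \<open>X\<close> keeps all sums finite. The three terms on the right bound
  \<open>partial_L X / (1 - t)\<close>, small since L = 0, then the sum over the Monsky weights,
  then the cut-off geometric tails. As \<open>X\<close> grows only \<open>2 * real N\<close>
  survives.\<close>

lemma lambert_series_bound:
  assumes L0: "L = 0" and t: "0 < t" "t < 1"
  shows "(\<Sum>n=1..X. (\<Sum>d | d dvd n. \<chi> d) * t ^ n)
    \<le> 2 * real N / real (Suc X) / (1 - t) + 2 * real N + real X * t ^ X / (1 - t)"
proof -
  have tn: "t ^ n < 1" "t ^ n \<le> t" if "n \<ge> 1" for n
    using t that power_decreasing[of 1 n t] by (auto simp: power_less_one_iff)
  have "(\<Sum>n=1..X. (\<Sum>d | d dvd n. \<chi> d) * t ^ n)
      = (\<Sum>n=1..X. \<Sum>d | d dvd n. \<chi> d * t ^ (d * (n div d)))"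
    by (simp add: sum_distrib_right)
  also have "\<dots> = (\<Sum>d=1..X. \<Sum>k=1..X div d. \<chi> d * t ^ (d * k))"
    by (rule sum_divisors_swap)
  also have "\<dots> = (\<Sum>d=1..X. \<chi> d * (t ^ d / (1 - t ^ d)) - \<chi> d * (t ^ (d * Suc (X div d)) / (1 - t ^ d)))"
  proof (rule sum.cong[OF refl])
    fix d assume d: "d \<in> {1..X}"
    have "(\<Sum>k=1..X div d. \<chi> d * t ^ (d * k)) = \<chi> d * (\<Sum>k=1..X div d. (t ^ d) ^ k)"
      by (simp add: sum_distrib_left power_mult)
    also have "(\<Sum>k=1..X div d. (t ^ d) ^ k) = (t ^ d - (t ^ d) ^ Suc (X div d)) / (1 - t ^ d)"
      using tn(1)[of d] d by (subst sum_gp) auto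
    finally show "(\<Sum>k=1..X div d. \<chi> d * t ^ (d * k))
        = \<chi> d * (t ^ d / (1 - t ^ d)) - \<chi> d * (t ^ (d * Suc (X div d)) / (1 - t ^ d))"
      by (simp only: power_mult diff_divide_distrib right_diff_distrib)
  qed
  also have "\<dots> = (\<Sum>d=1..X. \<chi> d * (t ^ d / (1 - t ^ d)))
      - (\<Sum>d=1..X. \<chi> d * (t ^ (d * Suc (X div d)) / (1 - t ^ d)))"
    by (rule sum_subtractf)
  also have "(\<Sum>d=1..X. \<chi> d * (t ^ d / (1 - t ^ d)))
      = partial_L X / (1 - t) - (\<Sum>d=1..X. \<chi> d * monsky_weight t d)"
    unfolding partial_L_def monsky_weight_def
    by (simp add: right_diff_distrib sum_subtractf sum_divide_distrib)
  also have "partial_L X / (1 - t) - (\<Sum>d=1..X. \<chi> d * monsky_weight t d)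
      - (\<Sum>d=1..X. \<chi> d * (t ^ (d * Suc (X div d)) / (1 - t ^ d)))
    \<le> 2 * real N / real (Suc X) / (1 - t) + 2 * real N + real X * t ^ X / (1 - t)"
  proof -
    have "partial_L X \<le> 2 * real N / real (Suc X)" using L_tail[of X] L0 by simp
    then have 1: "partial_L X / (1 - t) \<le> 2 * real N / real (Suc X) / (1 - t)"
      using t by (intro divide_right_mono) auto
    have "\<bar>\<Sum>d=1..X. \<chi> d * monsky_weight t d\<bar> \<le> 2 * real N * monsky_weight t 1"
      using t by (intro weighted_sum_bound monsky_weight_decreasing monsky_weight_nonneg) auto
    \<comment> \<open>The first weight does not depend on \<open>t\<close>, which makes the bound
      uniform as t tends to 1.\<close>
    moreover have "monsky_weight t 1 = 1"
      unfolding monsky_weight_def using t by (simp add: diff_divide_distrib[symmetric])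
    ultimately have 2: "\<bar>\<Sum>d=1..X. \<chi> d * monsky_weight t d\<bar> \<le> 2 * real N" by simp
    have "\<bar>\<Sum>d=1..X. \<chi> d * (t ^ (d * Suc (X div d)) / (1 - t ^ d))\<bar>
        \<le> (\<Sum>d=1..X. \<bar>\<chi> d * (t ^ (d * Suc (X div d)) / (1 - t ^ d))\<bar>)" by (rule sum_abs)
    also have "\<dots> \<le> (\<Sum>d=1..X. t ^ X / (1 - t))"
    proof (rule sum_mono)
      fix d assume d: "d \<in> {1..X}"
      \<comment> \<open>The first omitted exponent is at least X, and t^d <= t bounds the
        denominator below by 1 - t.\<close>
      have "X \<le> d * Suc (X div d)" using dividend_less_times_div[of d X] d by simp
      then have "t ^ (d * Suc (X div d)) / (1 - t ^ d) \<le> t ^ X / (1 - t)"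
        using t tn[of d] d by (intro frac_le power_decreasing) auto
      moreover have nn: "0 \<le> t ^ (d * Suc (X div d)) / (1 - t ^ d)" using t tn[of d] d by auto
      have "\<bar>\<chi> d * (t ^ (d * Suc (X div d)) / (1 - t ^ d))\<bar> \<le> 1 * (t ^ (d * Suc (X div d)) / (1 - t ^ d))"
        unfolding abs_mult abs_of_nonneg[OF nn] by (rule mult_right_mono[OF abs_le_1 nn])
      ultimately show "\<bar>\<chi> d * (t ^ (d * Suc (X div d)) / (1 - t ^ d))\<bar> \<le> t ^ X / (1 - t)"
        by linarith
    qed
    finally have 3: "\<bar>\<Sum>d=1..X. \<chi> d * (t ^ (d * Suc (X div d)) / (1 - t ^ d))\<bar> \<le> real X * t ^ X / (1 - t)"
      by simp
    show ?thesis using 1 2 3 by linarith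
  qed
  finally show ?thesis .
qed

text \<open>If L = 0, the squares 1, 4, ..., K^2 alone contribute at least K t^(K^2) to a Lambert
  series bounded by 2N. Letting t tend to 1 gives K <= 2N, false for K = 2N + 1.\<close>

lemma L_nonzero: "L \<noteq> 0"
proof
  assume L0: "L = 0"
  define K where "K = 2 * N + 1"
  have bound: "real K * t ^ (K^2) \<le> 2 * real N" if t: "0 < t" "t < 1" for t
  proof (rule LIMSEQ_le_const)
    have "(\<lambda>X. 2 * real N * inverse (real (Suc X)) / (1 - t) + 2 * real N + (real X * t ^ X) / (1 - t))
        \<longlonglongrightarrow> 2 * real N * 0 / (1 - t) + 2 * real N + 0 / (1 - t)"
      using t by (intro tendsto_intros LIMSEQ_inverse_real_of_nat powser_times_n_limit_0) auto
    then show "(\<lambda>X. 2 * real N / real (Suc X) / (1 - t) + 2 * real N + real X * t ^ X / (1 - t)) \<longlonglongrightarrow> 2 * real N"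
      by (simp add: divide_inverse)
    show "\<exists>M. \<forall>X\<ge>M. real K * t ^ (K^2)
        \<le> 2 * real N / real (Suc X) / (1 - t) + 2 * real N + real X * t ^ X / (1 - t)"
    proof (intro exI[of _ "K^2"] allI impI)
      fix X assume X: "X \<ge> K^2"
      have nonneg: "0 \<le> (\<Sum>d | d dvd n. \<chi> d)" if "n > 0" for n
        using sum_divisors_nonneg[of \<chi> n] mult one trichotomy that by blast
      have "real K * t ^ (K^2) = (\<Sum>k=1..K. t ^ (K^2))" by simp
      also have "\<dots> \<le> (\<Sum>k=1..K. (\<Sum>d | d dvd k^2. \<chi> d) * t ^ (k^2))"
      proof (rule sum_mono)
        fix k assume k: "k \<in> {1..K}"
        have "1 \<le> (\<Sum>d | d dvd k^2. \<chi> d)"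
          using sum_divisors_square_ge_1[of \<chi> k] mult one trichotomy k by auto
        moreover have "t ^ (K^2) \<le> t ^ (k^2)"
          using t k by (intro power_decreasing power_mono) auto
        ultimately have "1 * t ^ (K^2) \<le> (\<Sum>d | d dvd k^2. \<chi> d) * t ^ (k^2)"
          using t by (intro mult_mono) auto
        then show "t ^ (K^2) \<le> (\<Sum>d | d dvd k^2. \<chi> d) * t ^ (k^2)" by simp
      qed
      also have "\<dots> = (\<Sum>n\<in>(\<lambda>k. k^2) ` {1..K}. (\<Sum>d | d dvd n. \<chi> d) * t ^ n)"
        by (subst sum.reindex) (auto simp: inj_on_def)
      also have "\<dots> \<le> (\<Sum>n=1..X. (\<Sum>d | d dvd n. \<chi> d) * t ^ n)"
      proof (rule sum_mono2)
        show "(\<lambda>k. k^2) ` {1..K} \<subseteq> {1..X}"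
        proof
          fix n assume "n \<in> (\<lambda>k. k^2) ` {1..K}"
          then obtain k where k: "n = k^2" "1 \<le> k" "k \<le> K" by auto
          have "k^2 \<le> K^2" using k(3) by (rule power_mono) simp
          then have "k^2 \<le> X" using X by (rule order_trans)
          moreover have "1 \<le> k^2" using k(2) by simp
          ultimately show "n \<in> {1..X}" using k(1) by simp
        qed
      qed (use t nonneg in auto)
      also have "\<dots> \<le> 2 * real N / real (Suc X) / (1 - t) + 2 * real N + real X * t ^ X / (1 - t)"
        by (rule lambert_series_bound[OF L0 t])
      finally show "real K * t ^ (K^2)
        \<le> 2 * real N / real (Suc X) / (1 - t) + 2 * real N + real X * t ^ X / (1 - t)" .
    qed
  qed
  have "((\<lambda>t. real K * t ^ (K^2)) \<longlongrightarrow> real K * 1 ^ (K^2)) (at_left (1::real))"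
    by (intro tendsto_intros)
  moreover have "eventually (\<lambda>t. real K * t ^ (K^2) \<le> 2 * real N) (at_left (1::real))"
    using eventually_at_left_real[of 0 "1::real"] bound by (auto elim: eventually_mono)
  ultimately have "real K * 1 ^ (K^2) \<le> 2 * real N"
    by (rule tendsto_upperbound) simp
  then show False unfolding K_def by simp
qed

end

section \<open>Mertens' estimates\<close>

text \<open>Here n ln(1 + 1/n) <= 1 <= ln n; the second inequality needs n >= e, hence the start at
  3.\<close>

lemma ln_over_n_decreasing:
  assumes "3 \<le> n"
  shows "ln (real (Suc n)) / real (Suc n) \<le> ln (real n) / real n"
proof -
  have n: "real n > 0" using assms by simp
  have "ln (real (Suc n)) = ln (real n * (1 + 1 / real n))"
    using n by (simp add: distrib_left add.commute)
  also have "\<dots> = ln (real n) + ln (1 + 1 / real n)"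
    using n by (intro ln_mult_pos) (auto simp: add_pos_pos)
  also have "\<dots> \<le> ln (real n) + 1 / real n"
    using n ln_add_one_self_le_self[of "1 / real n"] by simp
  finally have "real n * ln (real (Suc n)) \<le> real n * (ln (real n) + 1 / real n)"
    using n by (intro mult_left_mono) auto
  also have "\<dots> = real n * ln (real n) + 1" using n by (simp add: distrib_left)
  also have "1 \<le> ln (real n)"
    using exp_le n assms by (subst ln_ge_iff) auto
  finally have "real n * ln (real (Suc n)) \<le> real (Suc n) * ln (real n)"
    by (simp add: algebra_simps)
  then show ?thesis using n by (simp add: pos_divide_le_eq pos_le_divide_eq mult_ac)
qed

context nonprincipal_character
begin

lemma ln_sum_bounded: "\<exists>C. \<forall>X. \<bar>\<Sum>n=1..X. \<chi> n * ln (real n) / real n\<bar> \<le> C"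
proof -
  let ?f = "\<lambda>n. \<chi> n * (ln (real n) / real n)"
  have "\<bar>\<Sum>n=1..X. ?f n\<bar> \<le> (\<Sum>n=1..2. \<bar>?f n\<bar>) + 2 * real N * (ln (real 3) / real 3)" for X
  proof -
    have "(\<Sum>n=1..X. ?f n) = (\<Sum>n\<in>{1..X} \<inter> {1..2}. ?f n) + (\<Sum>n=3..X. ?f n)"
      by (subst sum.union_disjoint[symmetric]) (auto intro: sum.cong)
    moreover have "\<bar>\<Sum>n\<in>{1..X} \<inter> {1..2}. ?f n\<bar> \<le> (\<Sum>n\<in>{1..X} \<inter> {1..2}. \<bar>?f n\<bar>)"
      by (rule sum_abs)
    moreover have "\<dots> \<le> (\<Sum>n=1..2. \<bar>?f n\<bar>)" by (intro sum_mono2) auto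
    moreover have "\<bar>\<Sum>n=3..X. ?f n\<bar> \<le> 2 * real N * (ln (real 3) / real 3)"
      by (intro weighted_sum_bound ln_over_n_decreasing) auto
    ultimately show ?thesis by linarith
  qed
  then show ?thesis unfolding times_divide_eq_right by blast
qed

text \<open>Writing ln as a divisor sum of \<open>mangoldt\<close> turns the bounded sum of
  \<chi>(n) ln(n) / n into the sum of \<open>a d * partial_L (X div d)\<close>. Replacing
  \<open>partial_L\<close> by \<open>L\<close> costs O(1) by \<open>L_tail\<close> and Chebyshev's
  bound, and the nonzero \<open>L\<close> can be divided out.\<close>

lemma mangoldt_sum_bounded: "\<exists>C. \<forall>X. \<bar>\<Sum>d=1..X. \<chi> d * mangoldt d / real d\<bar> \<le> C"
proof -
  obtain C where C: "\<And>X. \<bar>\<Sum>n=1..X. \<chi> n * ln (real n) / real n\<bar> \<le> C"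
    using ln_sum_bounded by blast
  define D where "D = 2 * real N * (3 * ln 4)"
  have "\<bar>\<Sum>d=1..X. \<chi> d * mangoldt d / real d\<bar> \<le> (C + D) / \<bar>L\<bar>" for X
  proof -
    define a where "a = (\<lambda>d. \<chi> d * mangoldt d / real d)"
    have "(\<Sum>n=1..X. \<chi> n * ln (real n) / real n)
        = (\<Sum>n=1..X. \<Sum>d | d dvd n. a d * (\<chi> (n div d) / real (n div d)))"
    proof (rule sum.cong[OF refl])
      fix n assume n: "n \<in> {1..X}"
      have "\<chi> n * ln (real n) / real n = (\<Sum>d | d dvd n. \<chi> n * mangoldt d / real n)"
        using n by (simp add: mangoldt_sum[of n, where 'a = real, simplified, symmetric]
            sum_distrib_left sum_divide_distrib)
      also have "\<dots> = (\<Sum>d | d dvd n. a d * (\<chi> (n div d) / real (n div d)))"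
      proof (rule sum.cong[OF refl])
        fix d assume "d \<in> {d. d dvd n}"
        then have "d * (n div d) = n" by simp
        then have "\<chi> n = \<chi> d * \<chi> (n div d)" "real n = real d * real (n div d)"
          using mult[of d "n div d"] of_nat_mult[of d "n div d"] by simp_all
        then show "\<chi> n * mangoldt d / real n = a d * (\<chi> (n div d) / real (n div d))"
          unfolding a_def by simp
      qed
      finally show "\<chi> n * ln (real n) / real n = (\<Sum>d | d dvd n. a d * (\<chi> (n div d) / real (n div d)))" .
    qed
    also have "\<dots> = (\<Sum>d=1..X. \<Sum>k=1..X div d. a d * (\<chi> k / real k))"
      by (rule sum_divisors_swap)
    also have "\<dots> = (\<Sum>d=1..X. a d * partial_L (X div d))"
      unfolding partial_L_def by (simp only: sum_distrib_left)
    also have "\<dots> = (\<Sum>d=1..X. a d) * L - (\<Sum>d=1..X. a d * (L - partial_L (X div d)))"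
      by (simp add: sum_distrib_right sum_subtractf[symmetric] right_diff_distrib)
    finally have split: "(\<Sum>n=1..X. \<chi> n * ln (real n) / real n)
        = (\<Sum>d=1..X. a d) * L - (\<Sum>d=1..X. a d * (L - partial_L (X div d)))" .
    have "\<bar>\<Sum>d=1..X. a d * (L - partial_L (X div d))\<bar> \<le> (\<Sum>d=1..X. \<bar>a d * (L - partial_L (X div d))\<bar>)"
      by (rule sum_abs)
    also have "\<dots> \<le> (\<Sum>d=1..X. mangoldt d * (2 * real N / real X))"
    proof (rule sum_mono)
      fix d assume d: "d \<in> {1..X}"
      have "X \<le> d * Suc (X div d)" using dividend_less_times_div[of d X] d by simp
      then have "real X \<le> real d * real (Suc (X div d))"
        unfolding of_nat_mult[symmetric] by (rule of_nat_mono)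
      then have N: "2 * real N / (real d * real (Suc (X div d))) \<le> 2 * real N / real X"
        using d by (intro divide_left_mono) auto
      have "\<bar>a d\<bar> = \<bar>\<chi> d\<bar> * (mangoldt d / real d)"
        unfolding a_def by (simp add: abs_mult)
      also have "\<dots> \<le> 1 * (mangoldt d / real d)"
        using mangoldt_nonneg[of d] by (intro mult_right_mono abs_le_1) auto
      finally have "\<bar>a d\<bar> \<le> mangoldt d / real d" by simp
      then have "\<bar>a d\<bar> * \<bar>L - partial_L (X div d)\<bar>
          \<le> (mangoldt d / real d) * (2 * real N / real (Suc (X div d)))"
        using L_tail[of "X div d"] mangoldt_nonneg[of d] by (intro mult_mono) auto
      also have "\<dots> = mangoldt d * (2 * real N / (real d * real (Suc (X div d))))"
        by simp
      also have "\<dots> \<le> mangoldt d * (2 * real N / real X)"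
        by (rule mult_left_mono[OF N mangoldt_nonneg])
      finally show "\<bar>a d * (L - partial_L (X div d))\<bar> \<le> mangoldt d * (2 * real N / real X)"
        by (simp only: abs_mult)
    qed
    also have "\<dots> = (\<Sum>d=1..X. mangoldt d) * (2 * real N / real X)"
      by (simp only: sum_distrib_right)
    also have "\<dots> \<le> (3 * ln 4 * real X) * (2 * real N / real X)"
      by (intro mult_right_mono chebyshev_upper_bound) auto
    also have "\<dots> \<le> D" unfolding D_def by (cases "X = 0") auto
    finally have "\<bar>(\<Sum>d=1..X. a d) * L\<bar> \<le> C + D" using split C[of X] by linarith
    then show ?thesis
      using L_nonzero unfolding a_def by (simp add: abs_mult pos_le_divide_eq)
  qed
  then show ?thesis by blast
qed

end

text \<open>A progression replaces the full Mertens asymptotics: the M numbers 1 + N j with M <= j <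
  2M are coprime to N, at most X = 2 M N, and have logarithm at least K. Expanding the logarithms
  over divisors bounds M K by X times the sum, which is therefore at least K / (2N) = |C| +
  1.\<close>

lemma coprime_mangoldt_sum_unbounded:
  fixes C :: real
  assumes N: "N > 0"
  obtains X where "C < (\<Sum>d=1..X. of_bool (coprime d N) * mangoldt d / real d)"
proof -
  define K where "K = 2 * real N * (\<bar>C\<bar> + 1)"
  define M where "M = nat \<lceil>exp K\<rceil>"
  have M: "exp K \<le> real M" "M > 0" unfolding M_def by (auto intro: less_le_trans[of 0 "exp K"])
  define X where "X = 2 * M * N"
  define f where "f = (\<lambda>d. of_bool (coprime d N) * mangoldt d / real d :: real)"
  have f0: "f d \<ge> 0" for d unfolding f_def using mangoldt_nonneg[of d] by simp
  have "real M * K \<le> (\<Sum>j=M..<2*M. K)" by simp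
  also have "\<dots> \<le> (\<Sum>j=M..<2*M. ln (real (1 + N * j)))"
  proof (rule sum_mono)
    fix j assume "j \<in> {M..<2*M}"
    then have "M \<le> j" by simp
    also have "j \<le> 1 + N * j" using N by (cases N) auto
    finally have "M \<le> 1 + N * j" .
    then have "exp K \<le> real (1 + N * j)" using M(1) by linarith
    then show "K \<le> ln (real (1 + N * j))" by (subst ln_ge_iff) (auto intro: add_pos_nonneg)
  qed
  also have "\<dots> = (\<Sum>n\<in>(\<lambda>j. 1 + N * j) ` {M..<2*M}. ln (real n))"
    using N by (subst sum.reindex) (auto simp: inj_on_def)
  also have "\<dots> = (\<Sum>n\<in>(\<lambda>j. 1 + N * j) ` {M..<2*M}. of_bool (coprime n N) * ln (real n))"
  proof (rule sum.cong[OF refl])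
    fix n assume "n \<in> (\<lambda>j. 1 + N * j) ` {M..<2*M}"
    then obtain j where j: "n = 1 + N * j" by blast
    have "coprime n N"
    proof (rule coprimeI)
      fix c assume "c dvd n" "c dvd N"
      then have "c dvd n - N * j" by (intro dvd_diff_nat dvd_mult2)
      then show "is_unit c" using j by simp
    qed
    then show "ln (real n) = of_bool (coprime n N) * ln (real n)" by simp
  qed
  also have "\<dots> \<le> (\<Sum>n=1..X. of_bool (coprime n N) * ln (real n))"
  proof (rule sum_mono2)
    show "(\<lambda>j. 1 + N * j) ` {M..<2*M} \<subseteq> {1..X}"
    proof
      fix n assume "n \<in> (\<lambda>j. 1 + N * j) ` {M..<2*M}"
      then obtain j where j: "n = 1 + N * j" "j \<in> {M..<2*M}" by blast
      have "1 + N * j \<le> N * Suc j" using N by simp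
      also have "\<dots> \<le> N * (2 * M)" using j(2) by (intro mult_left_mono) auto
      finally show "n \<in> {1..X}" using j(1) unfolding X_def by (simp add: mult_ac)
    qed
  qed auto
  also have "\<dots> \<le> (\<Sum>n=1..X. \<Sum>d | d dvd n. f d * real d)"
  proof (rule sum_mono)
    fix n assume n: "n \<in> {1..X}"
    have "of_bool (coprime n N) * ln (real n) = (\<Sum>d | d dvd n. of_bool (coprime n N) * mangoldt d)"
      using n by (simp add: mangoldt_sum[of n, where 'a = real, simplified, symmetric] sum_distrib_left)
    also have "\<dots> \<le> (\<Sum>d | d dvd n. f d * real d)"
    proof (rule sum_mono)
      fix d assume d: "d \<in> {d. d dvd n}"
      then have "d > 0" using n by (auto intro!: Nat.gr0I)
      then have "f d * real d = of_bool (coprime d N) * mangoldt d" unfolding f_def by simp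
      moreover have "coprime n N \<Longrightarrow> coprime d N" using coprime_divisors[of d n N N] d by simp
      ultimately show "of_bool (coprime n N) * mangoldt d \<le> f d * real d"
        using mangoldt_nonneg[of d] by auto
    qed
    finally show "of_bool (coprime n N) * ln (real n) \<le> (\<Sum>d | d dvd n. f d * real d)" .
  qed
  also have "\<dots> = (\<Sum>d=1..X. \<Sum>k=1..X div d. f d * real d)"
    by (rule sum_divisors_swap)
  also have "\<dots> = (\<Sum>d=1..X. f d * real (d * (X div d)))" by (simp add: mult_ac)
  also have "\<dots> \<le> (\<Sum>d=1..X. f d * real X)"
    by (intro sum_mono mult_left_mono f0) (simp add: times_div_less_eq_dividend del: of_nat_mult)
  also have "\<dots> = real M * (2 * real N * (\<Sum>d=1..X. f d))"
  proof -
    have "real X = real M * (2 * real N)" unfolding X_def by simp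
    then show ?thesis by (simp only: sum_distrib_right[symmetric]) (simp only: mult_ac)
  qed
  finally have "K \<le> 2 * real N * (\<Sum>d=1..X. f d)" using M(2) by simp
  then have "\<bar>C\<bar> + 1 \<le> (\<Sum>d=1..X. f d)" unfolding K_def using N by simp
  then show ?thesis using that[of X] unfolding f_def by linarith
qed

text \<open>
  Expand $\prod_i (1 + \epsilon_i x_i(n))$: only the principal term of
  $\sum \Lambda(n)/n \prod_i (1 + \epsilon_i x_i(n))$ is unbounded.
\<close>

theorem prime_power_with_character_values:
  fixes x :: "'i \<Rightarrow> nat \<Rightarrow> real" and \<epsilon> :: "'i \<Rightarrow> real"
  assumes fin: "finite I" and N: "N > 0"
    and char: "\<And>S. S \<subseteq> I \<Longrightarrow> S \<noteq> {} \<Longrightarrow>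
      nonprincipal_character N (\<lambda>n. of_bool (coprime n N) * (\<Prod>i\<in>S. x i n))"
    and \<epsilon>: "\<And>i. i \<in> I \<Longrightarrow> \<epsilon> i = 1 \<or> \<epsilon> i = -1"
  obtains p k where "prime p" "k > 0" "coprime p N" "\<And>i. i \<in> I \<Longrightarrow> x i (p ^ k) = \<epsilon> i"
proof -
  define F where "F = (\<lambda>n. of_bool (coprime n N) * (\<Prod>i\<in>I. 1 + \<epsilon> i * x i n) * mangoldt n / real n)"
  define G where "G = (\<lambda>S X. \<Sum>n=1..X. (of_bool (coprime n N) * (\<Prod>i\<in>S. x i n)) * mangoldt n / real n)"
  have "\<exists>C. \<forall>X. \<bar>G S X\<bar> \<le> C" if "S \<in> Pow I - {{}}" for S
    unfolding G_def by (rule nonprincipal_character.mangoldt_sum_bounded) (use that char in auto)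
  then obtain C where C: "\<And>S X. S \<in> Pow I - {{}} \<Longrightarrow> \<bar>G S X\<bar> \<le> C S" by metis
  obtain X where X: "(\<Sum>S\<in>Pow I - {{}}. C S) < G {} X"
    using coprime_mangoldt_sum_unbounded[OF N, of "\<Sum>S\<in>Pow I - {{}}. C S"] unfolding G_def by auto
  have "(\<Sum>n=1..X. F n) = (\<Sum>S\<in>Pow I. (\<Prod>i\<in>S. \<epsilon> i) * G S X)"
  proof -
    have "F n = (\<Sum>S\<in>Pow I. (\<Prod>i\<in>S. \<epsilon> i) * ((of_bool (coprime n N) * (\<Prod>i\<in>S. x i n)) * mangoldt n / real n))" for n
      using prod_add[OF fin, of "\<lambda>i. \<epsilon> i * x i n" "\<lambda>_. 1"] unfolding F_def
      by (simp add: add.commute prod.distrib sum_distrib_left sum_distrib_right sum_divide_distrib mult_ac)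
    then show ?thesis unfolding G_def by (simp only: sum_distrib_left) (rule sum.swap)
  qed
  also have "\<dots> = G {} X + (\<Sum>S\<in>Pow I - {{}}. (\<Prod>i\<in>S. \<epsilon> i) * G S X)"
    using fin by (subst sum.remove[of _ "{}"]) auto
  also have "\<dots> > 0"
  proof -
    have "\<bar>\<Sum>S\<in>Pow I - {{}}. (\<Prod>i\<in>S. \<epsilon> i) * G S X\<bar> \<le> (\<Sum>S\<in>Pow I - {{}}. \<bar>(\<Prod>i\<in>S. \<epsilon> i) * G S X\<bar>)"
      by (rule sum_abs)
    also have "\<dots> \<le> (\<Sum>S\<in>Pow I - {{}}. C S)"
    proof (rule sum_mono)
      fix S assume S: "S \<in> Pow I - {{}}"
      have "\<bar>\<Prod>i\<in>S. \<epsilon> i\<bar> = (\<Prod>i\<in>S. \<bar>\<epsilon> i\<bar>)" by (rule abs_prod)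
      also have "\<dots> = 1" using S \<epsilon> by (intro prod.neutral) fastforce
      finally show "\<bar>(\<Prod>i\<in>S. \<epsilon> i) * G S X\<bar> \<le> C S" using C[OF S] by (simp add: abs_mult)
    qed
    finally show ?thesis using X by linarith
  qed
  finally have "(\<Sum>n=1..X. F n) \<noteq> 0" by simp
  \<comment> \<open>At such an n no factor 1 + \<epsilon>_i x_i(n) vanishes, so each x_i(n), being 1
    or -1, equals \<epsilon>_i; and a nonzero \<open>mangoldt n\<close> makes n a prime
    power.\<close>
  then obtain n where "F n \<noteq> 0" by (meson sum.neutral)
  then have n: "coprime n N" "(\<Prod>i\<in>I. 1 + \<epsilon> i * x i n) \<noteq> 0" "(mangoldt n :: real) \<noteq> 0"
    unfolding F_def by auto
  from n(3) have "primepow n" unfolding mangoldt_def by (auto split: if_splits)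
  then obtain p k where pk: "prime p" "k > 0" "n = p ^ k" unfolding primepow_def by blast
  have "x i n = \<epsilon> i" if i: "i \<in> I" for i
  proof -
    interpret nonprincipal_character N "\<lambda>n. of_bool (coprime n N) * (\<Prod>i\<in>{i}. x i n)"
      using i by (intro char) auto
    have "x i n = 1 \<or> x i n = -1" using coprime[OF n(1)] n(1) by simp
    moreover have "1 + \<epsilon> i * x i n \<noteq> 0" using n(2) i fin by auto
    ultimately show ?thesis using \<epsilon>[OF i] by auto
  qed
  moreover have "coprime p N" using n(1) pk by simp
  ultimately show ?thesis using that pk by blast
qed

section \<open>Legendre symbols\<close>

lemma Legendre_cases: "Legendre a p = 0 \<or> Legendre a p = 1 \<or> Legendre a p = -1"
  by (simp add: Legendre_def)

lemma Legendre_cong: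
  assumes "[a = b] (mod p)"
  shows "Legendre a p = Legendre b p"
proof -
  have "[a = 0] (mod p) \<longleftrightarrow> [b = 0] (mod p)"
    using assms cong_trans cong_sym by blast
  moreover have "QuadRes p a \<longleftrightarrow> QuadRes p b"
    unfolding QuadRes_def using assms cong_trans cong_sym by blast
  ultimately show ?thesis by (simp add: Legendre_def)
qed

text \<open>Two of the values 0, 1, -1 differ by at most 2 < p. This lifts congruences from Euler's
  criterion to equalities.\<close>

lemma sign_eq_of_cong:
  fixes x y :: int
  assumes "[x = y] (mod int p)" "2 < p" "x = 0 \<or> x = 1 \<or> x = -1" "y = 0 \<or> y = 1 \<or> y = -1"
  shows "x = y"
proof (rule ccontr)
  assume "x \<noteq> y"
  then have "\<bar>int p\<bar> \<le> \<bar>x - y\<bar>"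
    using assms(1) by (intro dvd_imp_le_int) (auto simp: cong_iff_dvd_diff)
  then show False using assms(2-4) by auto
qed

lemma Legendre_mult:
  assumes "prime p" "2 < p"
  shows "Legendre (a * b) (int p) = Legendre a (int p) * Legendre b (int p)"
proof (rule sign_eq_of_cong)
  let ?k = "(p - 1) div 2"
  have "[Legendre a p * Legendre b p = a ^ ?k * b ^ ?k] (mod p)"
    using assms by (intro cong_mult euler_criterion)
  then have "[Legendre a p * Legendre b p = (a * b) ^ ?k] (mod p)"
    by (simp add: power_mult_distrib)
  with euler_criterion[OF assms, of "a * b"]
  show "[Legendre (a * b) (int p) = Legendre a (int p) * Legendre b (int p)] (mod int p)"
    by (metis cong_sym cong_trans)
  show "Legendre a (int p) * Legendre b (int p) = 0 \<or> Legendre a (int p) * Legendre b (int p) = 1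
      \<or> Legendre a (int p) * Legendre b (int p) = -1"
    using Legendre_cases[of a "int p"] Legendre_cases[of b "int p"] by auto
qed (use assms Legendre_cases in auto)

lemma Legendre_1:
  assumes "2 < p"
  shows "Legendre 1 (int p) = 1"
proof -
  have "QuadRes (int p) 1" unfolding QuadRes_def by (intro exI[of _ 1]) simp
  moreover have "\<not> [1 = 0] (mod int p)"
    using assms by (auto simp: cong_iff_dvd_diff zdvd1_eq)
  ultimately show ?thesis by (simp add: Legendre_def)
qed

lemma Legendre_prod:
  assumes "prime p" "2 < p" "finite S"
  shows "Legendre (\<Prod>i\<in>S. f i) (int p) = (\<Prod>i\<in>S. Legendre (f i) (int p))"
  using assms(3) by induction (simp_all add: Legendre_mult[OF assms(1,2)] Legendre_1[OF assms(2)])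

lemma Legendre_nonzero_iff:
  assumes "prime p"
  shows "Legendre (int n) (int p) \<noteq> 0 \<longleftrightarrow> \<not> p dvd n"
  by (simp add: Legendre_def cong_0_iff)

lemma square_root_of_Legendre:
  assumes "Legendre a (int p) = 1"
  shows "\<exists>r. int p dvd r^2 - a"
  using assms by (auto simp: Legendre_def QuadRes_def cong_iff_dvd_diff split: if_splits)

text \<open>Squaring on the nonzero residues identifies 1 with p - 1, and a non-injective self-map
  of a finite set misses some value.\<close>

lemma quadratic_nonresidue_exists:
  assumes "prime p" "2 < p"
  obtains b where "Legendre (int b) (int p) = -1"
proof -
  define f where "f = (\<lambda>y. y^2 mod p)"
  have "f ` {1..<p} \<subseteq> {1..<p}"
  proof
    fix z assume "z \<in> f ` {1..<p}"
    then obtain y where y: "z = y^2 mod p" "1 \<le> y" "y < p" unfolding f_def by auto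
    then have "\<not> p dvd y" by (auto dest: dvd_imp_le)
    then have "\<not> p dvd y^2" using assms(1) prime_dvd_power by blast
    then show "z \<in> {1..<p}" using y assms by (auto simp: dvd_eq_mod_eq_0 Suc_le_eq)
  qed
  moreover have "\<not> inj_on f {1..<p}"
  proof
    assume inj: "inj_on f {1..<p}"
    have "(p - 1)^2 = 1 + p * (p - 2)"
      using assms(2) by (cases p) (auto simp: power2_eq_square algebra_simps numeral_2_eq_2 Suc_diff_le split: nat.split)
    moreover have "(1 + p * (p - 2)) mod p = 1 mod p" by (rule mod_mult_self2)
    ultimately have "f (p - 1) = f 1" unfolding f_def by (simp only: power_one)
    then have "p - 1 = 1" using inj_onD[OF inj, of "p - 1" 1] assms(2) by simp
    then show False using assms(2) by simp
  qed
  ultimately obtain b where b: "b \<in> {1..<p}" "b \<notin> f ` {1..<p}"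
    using endo_inj_surj finite_surj_inj[of "{1..<p}" f] by blast
  have "\<not> QuadRes (int p) (int b)"
  proof
    assume "QuadRes (int p) (int b)"
    then obtain y where y: "[y^2 = int b] (mod int p)" unfolding QuadRes_def by blast
    define z where "z = nat (y mod int p)"
    have z: "int z = y mod int p" unfolding z_def using assms(2) by simp
    have "int (z^2 mod p) = y^2 mod int p"
      by (simp add: z zmod_int power_mod)
    also have "\<dots> = int b" using y b(1) unfolding cong_def by simp
    finally have fz: "f z = b" unfolding f_def by simp
    have "z < p" using z assms(2) by (metis of_nat_0_less_iff of_nat_less_iff order_less_trans pos2 pos_mod_bound)
    moreover have "z \<noteq> 0" using fz b(1) unfolding f_def by (cases z) auto
    ultimately show False using b(2) fz by force
  qed
  moreover have "\<not> [int b = 0] (mod int p)"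
    using b(1) by (auto simp: cong_0_iff dest: dvd_imp_le)
  ultimately show ?thesis using that[of b] by (simp add: Legendre_def)
qed

section \<open>Characters modulo 8 and the supplementary laws\<close>

text \<open>The Jacobi symbol (-1/n), and (2/n) in \<open>chi8\<close>, extended by 0 to even
  n.\<close>

definition chi4 :: "nat \<Rightarrow> int" where
  "chi4 n = (if even n then 0 else if n mod 4 = 1 then 1 else -1)"

definition chi8 :: "nat \<Rightarrow> int" where
  "chi8 n = (if even n then 0 else if n mod 8 = 1 \<or> n mod 8 = 7 then 1 else -1)"

lemma chi4_mult: "chi4 (m * n) = chi4 m * chi4 n"
proof -
  have "m mod 4 = 0 \<or> m mod 4 = 1 \<or> m mod 4 = 2 \<or> m mod 4 = 3"
    "n mod 4 = 0 \<or> n mod 4 = 1 \<or> n mod 4 = 2 \<or> n mod 4 = 3" by linarith+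
  moreover have "even k \<longleftrightarrow> k mod 4 = 0 \<or> k mod 4 = 2" for k :: nat by presburger
  moreover have "(m * n) mod 4 = ((m mod 4) * (n mod 4)) mod 4" by (simp add: mod_mult_eq)
  ultimately show ?thesis unfolding chi4_def by (elim disjE) simp_all
qed

lemma chi8_mult: "chi8 (m * n) = chi8 m * chi8 n"
proof (cases "even m \<or> even n")
  case True
  then show ?thesis by (auto simp: chi8_def)
next
  case False
  then have "m mod 8 = 1 \<or> m mod 8 = 3 \<or> m mod 8 = 5 \<or> m mod 8 = 7"
    "n mod 8 = 1 \<or> n mod 8 = 3 \<or> n mod 8 = 5 \<or> n mod 8 = 7" by presburger+
  moreover have "(m * n) mod 8 = ((m mod 8) * (n mod 8)) mod 8" by (simp add: mod_mult_eq)
  ultimately show ?thesis using False unfolding chi8_def by (elim disjE) simp_all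
qed

lemma chi4_prod: "finite S \<Longrightarrow> chi4 (\<Prod>i\<in>S. f i) = (\<Prod>i\<in>S. chi4 (f i))"
proof (induction rule: finite_induct)
  case empty
  show ?case by (simp add: chi4_def)
next
  case (insert i S)
  then show ?case by (simp add: chi4_mult)
qed

lemma chi4_mod: "chi4 (n mod 8) = chi4 n" and chi8_mod: "chi8 (n mod 8) = chi8 n"
proof -
  have "even (n mod 8) \<longleftrightarrow> even n" by (simp add: dvd_mod_iff)
  moreover have "n mod 8 mod 4 = n mod 4" by (simp add: mod_mod_cancel)
  ultimately show "chi4 (n mod 8) = chi4 n" "chi8 (n mod 8) = chi8 n"
    unfolding chi4_def chi8_def by simp_all
qed

lemma Legendre_minus_1:
  assumes "prime p" "2 < p"
  shows "Legendre (-1) (int p) = chi4 p"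
proof (rule sign_eq_of_cong)
  have "odd p" using assms prime_odd_nat by blast
  then have "(-1) ^ ((p - 1) div 2) = chi4 p"
  proof -
    have "even ((p - 1) div 2) \<longleftrightarrow> p mod 4 = 1" using \<open>odd p\<close> by presburger
    then show ?thesis using \<open>odd p\<close> by (simp add: chi4_def uminus_power_if)
  qed
  then show "[Legendre (-1) (int p) = chi4 p] (mod int p)"
    using euler_criterion[OF assms, of "-1"] by simp
qed (use assms Legendre_cases in \<open>auto simp: chi4_def\<close>)

text \<open>Gauss' lemma with q = 4k + 1: the doubles of 1, ..., 2k stay below q, so no reduction
  takes place, and exactly the k doubles of k + 1, ..., 2k exceed (q - 1)/2.\<close>

lemma Legendre_2:
  assumes "prime q" "q mod 4 = 1"
  shows "Legendre 2 (int q) = chi8 q"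
proof -
  have q2: "2 < q" using assms prime_ge_2_nat[of q] by (cases "q = 2") auto
  interpret GAUSS q 2
  proof
    show "[2 \<noteq> 0] (mod int q)"
      using q2 by (auto simp: cong_0_iff dest: zdvd_imp_le)
  qed (use assms q2 in auto)
  define k where "k = q div 4"
  have "q = 4 * k + 1" using assms(2) unfolding k_def by presburger
  then have q: "int q = 4 * int k + 1" by simp
  have "C = B"
    unfolding C_def B_def A_def using q by (auto simp: image_iff)
  then have "E = (\<lambda>x. x * 2) ` {int k + 1..2 * int k}"
    unfolding E_def B_def A_def using q by auto
  then have "card E = k" by (simp add: card_image inj_on_def)
  then have "Legendre 2 (int q) = (-1) ^ k" using gauss_lemma by simp
  also have "\<dots> = chi8 q"
  proof -
    have "q mod 8 = (if even k then 1 else 5)" unfolding \<open>q = 4 * k + 1\<close> by presburger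
    with \<open>q = 4 * k + 1\<close> show ?thesis by (simp add: chi8_def)
  qed
  finally show ?thesis .
qed

lemma Legendre_reciprocity_1_mod_4:
  assumes "prime p" "2 < p" "prime q" "q mod 4 = 1" "p \<noteq> q"
  shows "Legendre (int p) (int q) = Legendre (int q) (int p)"
proof -
  have q2: "2 < q" using assms prime_ge_2_nat[of q] by (cases "q = 2") auto
  have "even ((q - 1) div 2)" using assms(4) by presburger
  then have "Legendre (int p) (int q) * Legendre (int q) (int p) = 1"
    using Quadratic_Reciprocity[OF assms(1,2,3) q2 assms(5)] by simp
  then show ?thesis
    using Legendre_cases[of "int p" "int q"] Legendre_cases[of "int q" "int p"] by auto
qed

lemma squarefree_eq_prod_prime_factors:
  fixes m :: nat
  assumes "squarefree m"
  shows "m = \<Prod>(prime_factors m)"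
proof -
  have m0: "m \<noteq> 0" using assms by (metis not_squarefree_0)
  have "m = (\<Prod>p\<in>prime_factors m. p ^ multiplicity p m)"
    using m0 by (intro prime_factorization_nat) auto
  also have "\<dots> = \<Prod>(prime_factors m)"
  proof (rule prod.cong[OF refl])
    fix p assume p: "p \<in> prime_factors m"
    then have "multiplicity p m = 1"
      using assms squarefree_factorial_semiring'[OF m0] by blast
    then show "p ^ multiplicity p m = p" by simp
  qed
  finally show ?thesis .
qed

lemma squarefree_dvd_of_primes:
  fixes m :: nat and X :: int
  assumes "squarefree m" "\<And>p. prime p \<Longrightarrow> p dvd m \<Longrightarrow> int p dvd X"
  shows "int m dvd X"
proof -
  have "int (\<Prod>p\<in>S. p) dvd X" if "finite S" "S \<subseteq> prime_factors m" for S
    using that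
  proof (induction S rule: finite_induct)
    case (insert p S)
    have "coprime (int p) (int (\<Prod>p\<in>S. p))"
      unfolding coprime_int_iff
      using insert by (intro prod_coprime_right) (auto intro!: primes_coprime)
    moreover have "int p dvd X" using assms(2) insert by auto
    ultimately have "int p * int (\<Prod>p\<in>S. p) dvd X" using insert by (intro divides_mult) auto
    then show ?case using insert by simp
  qed simp
  then show ?thesis using squarefree_eq_prod_prime_factors[OF assms(1)] by (metis finite_set_mset order_refl)
qed

text \<open>Chinese remaindering glues the roots modulo the primes; squarefreeness spares any
  lifting to prime powers.\<close>

lemma square_mod_squarefree:
  fixes m :: nat and a :: int
  assumes sf: "squarefree m" and res: "\<And>p. prime p \<Longrightarrow> p dvd m \<Longrightarrow> \<exists>r. int p dvd r^2 + a"
  shows "\<exists>r. int m dvd r^2 + a"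
proof -
  define P where "P = prime_factors m"
  have m0: "m \<noteq> 0" using sf by (metis not_squarefree_0)
  have "\<exists>r::nat. int p dvd (int r)^2 + a" if p: "p \<in> P" for p
  proof -
    have pp: "prime p" "p dvd m" using p unfolding P_def by auto
    obtain r where r: "int p dvd r^2 + a" using res[OF pp] by blast
    have "int (nat (r mod int p)) = r mod int p" using prime_gt_0_nat[OF pp(1)] by simp
    moreover have "[(r mod int p)^2 + a = r^2 + a] (mod int p)"
      by (intro cong_add cong_pow) (auto simp: cong_def)
    ultimately show ?thesis using r by (metis cong_dvd_iff)
  qed
  then obtain u :: "nat \<Rightarrow> nat" where u: "\<And>p. p \<in> P \<Longrightarrow> int p dvd (int (u p))^2 + a" by metis
  have "\<exists>x. \<forall>p\<in>P. [x = u p] (mod p)"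
    unfolding P_def by (rule chinese_remainder_nat) (auto intro: primes_coprime)
  then obtain x where x: "\<And>p. p \<in> P \<Longrightarrow> [x = u p] (mod p)" by blast
  have "int m dvd (int x)^2 + a"
  proof (rule squarefree_dvd_of_primes[OF sf])
    fix p assume "prime p" "p dvd m"
    then have p: "p \<in> P" using m0 unfolding P_def by (simp add: in_prime_factors_iff)
    have "[int x = int (u p)] (mod int p)" using x[OF p] by (simp add: cong_int_iff)
    then have "[(int x)^2 + a = (int (u p))^2 + a] (mod int p)"
      by (intro cong_add cong_pow) auto
    then show "int p dvd (int x)^2 + a" using u[OF p] cong_dvd_iff by blast
  qed
  then show ?thesis by blast
qed

section \<open>Sums of three squares\<close>

lemma nearest_multiple:
  fixes x w :: int
  assumes "w > 0"
  obtains X where "4 * (x - w * X)^2 \<le> w^2"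
proof -
  \<comment> \<open>The floor of x/w + 1/2, a nearest integer to x/w.\<close>
  define X where "X = (2 * x + w) div (2 * w)"
  have *: "2 * x + w = 2 * w * X + (2 * x + w) mod (2 * w)"
    unfolding X_def by simp
  have "0 \<le> (2 * x + w) mod (2 * w)" "(2 * x + w) mod (2 * w) < 2 * w"
    using assms by auto
  with * have "\<bar>2 * (x - w * X)\<bar> \<le> \<bar>w\<bar>"
    by (simp add: algebra_simps)
  then have "(2 * (x - w * X))^2 \<le> w^2"
    by (simp only: abs_le_square_iff)
  moreover have "(2 * (x - w * X))^2 = 4 * (x - w * X)^2"
    by (simp only: power_mult_distrib) simp
  ultimately show ?thesis
    using that by metis
qed

text \<open>
  The Davenport--Cassels descent: the line through the rational point $(x,y,z)/w$ of the sphere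
  and its nearest lattice point $(X,Y,Z)$ meets the sphere again in a point whose denominator is smaller.
\<close>

lemma three_squares_of_rational:
  fixes m w x y z :: int
  assumes "w > 0" "m * w^2 = x^2 + y^2 + z^2"
  shows "\<exists>a b c. m = a^2 + b^2 + c^2"
  using assms
proof (induction "nat w" arbitrary: w x y z rule: less_induct)
  case less
  obtain X where X: "4 * (x - w * X)^2 \<le> w^2" by (rule nearest_multiple[OF less.prems(1)])
  obtain Y where Y: "4 * (y - w * Y)^2 \<le> w^2" by (rule nearest_multiple[OF less.prems(1)])
  obtain Z where Z: "4 * (z - w * Z)^2 \<le> w^2" by (rule nearest_multiple[OF less.prems(1)])
  define D where "D = (x - w * X)^2 + (y - w * Y)^2 + (z - w * Z)^2"
  define S where "S = x * X + y * Y + z * Z"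
  define R where "R = X^2 + Y^2 + Z^2"
  \<comment> \<open>The new denominator: it equals D / w, and the equation for m w^2 shows that this
    is an integer.\<close>
  define w' where "w' = m * w - 2 * S + w * R"
  have Dw: "D = w * w'"
  proof -
    have "D = (x^2 + y^2 + z^2) - 2 * w * S + w^2 * R"
      unfolding D_def S_def R_def by (simp add: algebra_simps power2_eq_square)
    then show ?thesis
      unfolding less.prems(2)[symmetric] w'_def by (simp add: algebra_simps power2_eq_square)
  qed
  show ?case
  proof (cases "D = 0")
    case True
    then have "(x - w * X)^2 = 0" "(y - w * Y)^2 = 0" "(z - w * Z)^2 = 0"
      unfolding D_def by (smt (verit) zero_le_power2)+
    then have "x = w * X" "y = w * Y" "z = w * Z" by auto
    with less.prems(2) have "w^2 * m = w^2 * (X^2 + Y^2 + Z^2)"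
      by (simp add: algebra_simps power_mult_distrib)
    with less.prems(1) have "m = X^2 + Y^2 + Z^2" by simp
    then show ?thesis by blast
  next
    case False
    have "D \<ge> 0" unfolding D_def by simp
    with False have "w * w' > 0" using Dw by linarith
    with less.prems(1) have w'0: "w' > 0" by (simp add: zero_less_mult_iff)
    \<comment> \<open>Three squares of at most w^2/4 each give D <= 3 w^2/4, hence w' < w; a fourth
      coordinate would only give w' <= w.\<close>
    have "4 * D = 4 * (x - w * X)^2 + 4 * (y - w * Y)^2 + 4 * (z - w * Z)^2"
      unfolding D_def by (simp only: distrib_left)
    also have "\<dots> \<le> w^2 + w^2 + w^2" by (intro add_mono X Y Z)
    finally have "4 * D \<le> 3 * w^2" by simp
    moreover have "w^2 > 0" using less.prems(1) by simp
    ultimately have "w * w' < w * w" using Dw by (simp add: power2_eq_square)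
    with less.prems(1) have w'w: "w' < w" by simp
    \<comment> \<open>The second intersection point is (a x + b X, a y + b Y, a z + b Z) / w',
      obtained from the quadratic equation on the line, whose other root is the known point.\<close>
    define a where "a = R - m"
    define b where "b = 2 * (m * w - S)"
    have w'': "w' = a * w + b" unfolding w'_def a_def b_def by (simp add: algebra_simps)
    have "(a * x + b * X)^2 + (a * y + b * Y)^2 + (a * z + b * Z)^2
        = a^2 * (x^2 + y^2 + z^2) + a * b * (2 * S) + b^2 * R"
      unfolding S_def R_def by (simp add: algebra_simps power2_eq_square)
    also have "\<dots> = a^2 * (m * w^2) + a * b * (2 * S) + b^2 * R"
      by (simp only: less.prems(2))
    also have "\<dots> = m * w'^2"
    proof -
      have "R = a + m" "2 * S = 2 * m * w - b" unfolding a_def b_def by simp_all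
      then have "a^2 * (m * w^2) + a * b * (2 * S) + b^2 * R
          = a^2 * (m * w^2) + a * b * (2 * m * w - b) + b^2 * (a + m)"
        by (simp only:)
      also have "\<dots> = m * w'^2"
        unfolding w'' by (simp add: algebra_simps power2_eq_square)
      finally show ?thesis .
    qed
    finally have "m * w'^2 = (a * x + b * X)^2 + (a * y + b * Y)^2 + (a * z + b * Z)^2"
      by (rule sym)
    moreover have "nat w' < nat w" using w'0 w'w by simp
    ultimately show ?thesis using w'0 by (intro less.hyps)
  qed
qed

section \<open>Legendre's equation by the pigeonhole principle\<close>

text \<open>Strictness on the left makes differences within {0..A} have squares below n, while that
  range still has at least sqrt(n) points; this fits the pigeonhole box below.\<close>

lemma square_bracket:
  fixes n :: int
  assumes "n > 0"
  obtains A where "A \<ge> 0" "A^2 < n" "n \<le> (A + 1)^2"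
proof -
  have ex: "n \<le> (int (nat n) + 1)^2"
    using assms by (simp add: power2_eq_square algebra_simps)
  define k where "k = (LEAST k. n \<le> (int k + 1)^2)"
  have k: "n \<le> (int k + 1)^2" unfolding k_def using ex by (rule LeastI)
  have "(int k)^2 < n"
  proof (cases k)
    case 0
    then show ?thesis using assms by simp
  next
    case (Suc j)
    then have "\<not> n \<le> (int j + 1)^2" unfolding k_def by (metis lessI not_less_Least)
    then show ?thesis using Suc by (simp add: add.commute)
  qed
  with k show ?thesis by (intro that[of "int k"]) auto
qed

text \<open>
  Pigeonhole in a box of more than $mq$ points gives a nonzero point with
  $T = mw^2 - z^2 - qu^2$ divisible by $mq$ and $-2mq < T < mq$. If $T = -mq$, multiply by $w^2 + q$.
\<close>

lemma legendre_equation_solvable: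
  fixes m q \<rho> \<sigma> :: int
  assumes m: "m > 0" and q: "q > 0" and cop: "coprime m q"
    and \<rho>: "m dvd \<rho>^2 + q" and \<sigma>: "q dvd \<sigma>^2 - m"
  obtains w z u where "w > 0" "m * w^2 = z^2 + q * u^2"
proof -
  obtain A where A: "A \<ge> 0" "A^2 < q" "q \<le> (A + 1)^2" by (rule square_bracket[OF q])
  obtain C where C: "C \<ge> 0" "C^2 < m" "m \<le> (C + 1)^2" by (rule square_bracket[OF m])
  have mq: "m * q > 0" using m q by simp
  \<comment> \<open>The bracket is taken at m q + 1: B^2 <= m q still holds, but (B + 1)^2 > m q
    makes the box strictly larger than m q.\<close>
  then obtain B where B: "B \<ge> 0" "B^2 < m * q + 1" "m * q + 1 \<le> (B + 1)^2"
    using square_bracket[of "m * q + 1"] by auto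
  have "m * q < (A + 1) * (C + 1) * (B + 1)"
  proof -
    have "(m * q)^2 = (q * m) * (m * q)" by (simp add: power2_eq_square)
    also have "\<dots> < (q * m) * (B + 1)^2"
      using mq B(3) by (intro mult_strict_left_mono) (auto simp: mult.commute)
    also have "\<dots> \<le> ((A + 1)^2 * (C + 1)^2) * (B + 1)^2"
      using A(3) C(3) m q by (intro mult_right_mono mult_mono) auto
    also have "\<dots> = ((A + 1) * (C + 1) * (B + 1))^2"
      by (simp only: power_mult_distrib)
    finally show ?thesis
      by (rule power2_less_imp_less) (use A(1) B(1) C(1) in simp)
  qed
  then have big: "m * q < (A + 1) * (B + 1) * (C + 1)" by (simp only: mult_ac)
  define Box where "Box = {0..A} \<times> {0..B} \<times> {0..C}"
  \<comment> \<open>A collision gives differences with z = \<rho> u mod m and z = \<sigma> w mod q;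
    then z^2 + q u^2 vanishes modulo m and m w^2 - z^2 modulo q.\<close>
  define f where "f = (\<lambda>(w, z, u). ((z - \<rho> * u) mod m, (z - \<sigma> * w) mod q))"
  have "card (f ` Box) \<le> card ({0..<m} \<times> {0..<q})"
    using m q by (intro card_mono) (auto simp: f_def)
  also have "\<dots> = nat (m * q)"
    using m q by (simp add: card_cartesian_product nat_mult_distrib)
  also have "\<dots> < nat ((A + 1) * (B + 1) * (C + 1))"
    using big mq by simp
  also have "\<dots> = card Box"
    using A(1) B(1) C(1) unfolding Box_def
    by (simp add: card_cartesian_product nat_mult_distrib mult.assoc)
  finally have "\<not> inj_on f Box" by (rule pigeonhole)
  then obtain w1 z1 u1 w2 z2 u2 where
    p1: "(w1, z1, u1) \<in> Box" and p2: "(w2, z2, u2) \<in> Box"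
    and ne: "(w1, z1, u1) \<noteq> (w2, z2, u2)" and eq: "f (w1, z1, u1) = f (w2, z2, u2)"
    unfolding inj_on_def by (metis prod_cases3)
  define w where "w = w1 - w2"
  define z where "z = z1 - z2"
  define u where "u = u1 - u2"
  define T where "T = m * w^2 - z^2 - q * u^2"
  have ne0: "w \<noteq> 0 \<or> z \<noteq> 0 \<or> u \<noteq> 0"
    using ne unfolding w_def z_def u_def by auto
  have "\<bar>w\<bar> \<le> \<bar>A\<bar>" "\<bar>z\<bar> \<le> \<bar>B\<bar>" "\<bar>u\<bar> \<le> \<bar>C\<bar>"
    using p1 p2 unfolding Box_def w_def z_def u_def by auto
  then have "w^2 \<le> A^2" "z^2 \<le> B^2" "u^2 \<le> C^2"
    by (simp_all only: abs_le_square_iff)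
  with A B C have bounds: "w^2 < q" "z^2 \<le> m * q" "u^2 < m" by linarith+
  have "m * w^2 < m * q" using bounds(1) m by simp
  moreover have "q * u^2 < q * m" using bounds(3) q by simp
  moreover have "0 \<le> q * u^2" "0 \<le> m * w^2" using m q by simp_all
  ultimately have T: "T < m * q" "- 2 * (m * q) < T"
    unfolding T_def using bounds(2) zero_le_power2[of z] by (smt (verit) mult.commute)+
  have "m dvd (z1 - \<rho> * u1) - (z2 - \<rho> * u2)" "q dvd (z1 - \<sigma> * w1) - (z2 - \<sigma> * w2)"
    using eq unfolding f_def by (auto simp: mod_eq_dvd_iff)
  then have dz: "m dvd z - \<rho> * u" "q dvd z - \<sigma> * w"
    unfolding z_def u_def w_def by (simp_all add: algebra_simps)
  have "T = m * w^2 - (z - \<rho> * u) * (z + \<rho> * u) - (\<rho>^2 + q) * u^2"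
    unfolding T_def by (simp add: algebra_simps power2_eq_square)
  then have "m dvd T" using dz(1) \<rho> by (simp add: dvd_diff dvd_mult2)
  moreover have "T = - ((z - \<sigma> * w) * (z + \<sigma> * w)) - (\<sigma>^2 - m) * w^2 - q * u^2"
    unfolding T_def by (simp add: algebra_simps power2_eq_square)
  then have "q dvd T" using dz(2) \<sigma> by (simp add: dvd_diff dvd_mult2)
  ultimately have "m * q dvd T" using cop by (rule divides_mult)
  then obtain k where k: "T = m * q * k" by blast
  have "m * q * k < m * q * 1" "m * q * (-2) < m * q * k" using T k by simp_all
  then have "k < 1" "-2 < k" using mq by (simp_all only: mult_less_cancel_left_pos)
  then consider "k = 0" | "k = -1" by linarith
  then show ?thesis
  proof cases
    case 1
    then have e: "m * w^2 = z^2 + q * u^2" using k unfolding T_def by simp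
    have "w \<noteq> 0"
    proof
      assume "w = 0"
      with e have "z^2 + q * u^2 = 0" by simp
      moreover have "0 \<le> q * u^2" using q by simp
      ultimately have "z^2 = 0" "q * u^2 = 0" by (smt (verit) zero_le_power2)+
      with \<open>w = 0\<close> ne0 q show False by simp
    qed
    with e show ?thesis by (intro that[of "\<bar>w\<bar>"]) auto
  next
    case 2
    then have "z^2 + q * u^2 = m * (w^2 + q)" using k unfolding T_def by (simp add: algebra_simps)
    then have "m * (w^2 + q)^2 = (z^2 + q * u^2) * (w^2 + q)"
      by (simp add: power2_eq_square algebra_simps)
    \<comment> \<open>Brahmagupta's identity for the form a^2 + q b^2 at (z, u) and (w, 1).\<close>
    also have "\<dots> = (z * w + q * u)^2 + q * (z - u * w)^2"
      by (simp add: power2_eq_square algebra_simps)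
    finally show ?thesis
      using q by (intro that[of "w^2 + q"]) (auto simp: add_nonneg_pos)
  qed
qed

text \<open>
  Since $q u'^2$ is a sum of two squares, multiplying a solution of $m w^2 = z^2 + q u^2$ by $u'^2$
  writes $m$ as a sum of three rational squares.
\<close>

lemma three_squares_criterion:
  fixes m q \<rho> \<sigma> \<tau> :: int
  assumes "m > 0" "q > 0" "coprime m q" "m dvd \<rho>^2 + q" "q dvd \<sigma>^2 - m" "q dvd \<tau>^2 + 1"
  shows "\<exists>a b c. m = a^2 + b^2 + c^2"
proof -
  obtain w z u where 1: "w > 0" "m * w^2 = z^2 + q * u^2"
    using legendre_equation_solvable[OF assms(1-5)] .
  \<comment> \<open>The same equation for the pair (q, 1): -1 is a square modulo q by \<tau>, and
    the condition modulo 1 is empty.\<close>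
  obtain u' s t where 2: "u' > 0" "q * u'^2 = s^2 + 1 * t^2"
    using legendre_equation_solvable[of q 1 \<tau> 0] assms(2,6) by auto
  have "m * (w * u')^2 = z^2 * u'^2 + (q * u'^2) * u^2"
    using arg_cong[OF 1(2), of "\<lambda>x. x * u'^2"] by (simp add: power_mult_distrib algebra_simps)
  also have "\<dots> = (z * u')^2 + (s * u)^2 + (t * u)^2"
    unfolding 2(2) by (simp add: power_mult_distrib algebra_simps)
  finally show ?thesis using three_squares_of_rational[of "w * u'"] 1(1) 2(1) by simp
qed

section \<open>Genus characters and primes with prescribed signs\<close>

text \<open>The labels 1 and 2 are not odd primes, so they can name the two characters modulo 8;
  every other label is meant as an odd prime.\<close>

definition genus_character :: "nat \<Rightarrow> nat \<Rightarrow> int" where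
  "genus_character i n =
    (if i = 1 then chi4 n else if i = 2 then chi8 n else Legendre (int n) (int i))"

lemma coprime_8_iff_odd: "coprime n (8::nat) \<longleftrightarrow> odd n"
proof -
  have "coprime n ((2::nat) ^ 3) \<longleftrightarrow> odd n"
    by (simp only: coprime_power_right_iff coprime_right_2_iff_odd) simp
  moreover have "(2::nat) ^ 3 = 8" by simp
  ultimately show ?thesis by metis
qed

context
  fixes P :: "nat set"
  assumes finite_P: "finite P" and odd_primes: "\<And>p. p \<in> P \<Longrightarrow> prime p \<and> 2 < p"
begin

lemma coprime_8_prod_iff: "coprime n (8 * \<Prod>P) \<longleftrightarrow> odd n \<and> (\<forall>p\<in>P. \<not> p dvd n)"
proof -
  have "coprime n (\<Prod>P) \<longleftrightarrow> (\<forall>p\<in>P. \<not> p dvd n)"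
  proof
    assume cop: "coprime n (\<Prod>P)"
    show "\<forall>p\<in>P. \<not> p dvd n"
    proof (intro ballI notI)
      fix p assume p: "p \<in> P" "p dvd n"
      then have "p dvd \<Prod>P" using finite_P by (intro dvd_prodI) auto
      with p(2) cop have "is_unit p" by (metis coprime_common_divisor)
      then show False using odd_primes[OF p(1)] by auto
    qed
  next
    assume *: "\<forall>p\<in>P. \<not> p dvd n"
    show "coprime n (\<Prod>P)"
    proof (rule prod_coprime_right)
      fix p assume "p \<in> P"
      then show "coprime n p"
        using * odd_primes by (metis coprime_commute prime_imp_coprime_nat)
    qed
  qed
  then show ?thesis by (simp add: coprime_mult_right_iff coprime_8_iff_odd)
qed

lemma genus_character_mult:
  assumes "i \<in> {1, 2} \<union> P"
  shows "genus_character i (m * n) = genus_character i m * genus_character i n"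
  using assms odd_primes[of i] Legendre_mult[of i "int m" "int n"]
  by (auto simp: genus_character_def chi4_mult chi8_mult)

lemma genus_character_one:
  assumes "i \<in> {1, 2} \<union> P"
  shows "genus_character i 1 = 1"
  using assms odd_primes[of i] Legendre_1[of i]
  by (auto simp: genus_character_def chi4_def chi8_def)

lemma genus_character_power:
  assumes "i \<in> {1, 2} \<union> P"
  shows "genus_character i (n ^ k) = genus_character i n ^ k"
proof (induction k)
  case 0
  show ?case using genus_character_one[OF assms] by simp
next
  case (Suc k)
  then show ?case by (simp add: genus_character_mult[OF assms])
qed

lemma genus_character_cong:
  assumes "i \<in> {1, 2} \<union> P" "m mod 8 = n mod 8" "i \<in> P \<Longrightarrow> [m = n] (mod i)"
  shows "genus_character i m = genus_character i n"
proof -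
  have "chi4 m = chi4 n" "chi8 m = chi8 n"
    using chi4_mod[of m] chi4_mod[of n] chi8_mod[of m] chi8_mod[of n] assms(2) by simp_all
  moreover have "Legendre (int m) (int i) = Legendre (int n) (int i)" if "i \<in> P"
    using assms(3)[OF that] by (intro Legendre_cong) (simp add: cong_int_iff)
  ultimately show ?thesis using assms(1) by (auto simp: genus_character_def)
qed

lemma genus_character_unit:
  assumes "i \<in> {1, 2} \<union> P" "coprime n (8 * \<Prod>P)"
  shows "genus_character i n = 1 \<or> genus_character i n = -1"
proof -
  have n: "odd n" "\<And>p. p \<in> P \<Longrightarrow> \<not> p dvd n" using assms(2) coprime_8_prod_iff by auto
  have "Legendre (int n) (int i) \<noteq> 0" if "i \<in> P"
    using n(2)[OF that] odd_primes[OF that] Legendre_nonzero_iff by blast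
  then show ?thesis
    using assms(1) n(1) Legendre_cases[of "int n" "int i"]
    by (auto simp: genus_character_def chi4_def chi8_def)
qed

lemma crt_8_prod:
  fixes c :: nat and b :: "nat \<Rightarrow> nat"
  obtains a where "a mod 8 = c mod 8" "\<And>p. p \<in> P \<Longrightarrow> [a = b p] (mod p)"
proof -
  have "\<exists>y. \<forall>p\<in>P. [y = b p] (mod p)"
    using finite_P odd_primes by (intro chinese_remainder_nat) (auto intro: primes_coprime)
  then obtain y where y: "\<And>p. p \<in> P \<Longrightarrow> [y = b p] (mod p)" by blast
  have "coprime 8 (\<Prod>P)"
  proof (rule prod_coprime_right)
    fix p assume "p \<in> P"
    then have "odd p" using odd_primes prime_odd_nat by blast
    then show "coprime 8 p" by (simp add: coprime_8_iff_odd coprime_commute)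
  qed
  then obtain a where a: "[a = c] (mod 8)" "[a = y] (mod \<Prod>P)"
    using binary_chinese_remainder_nat by blast
  have "[a = b p] (mod p)" if "p \<in> P" for p
    using cong_dvd_modulus_nat[OF a(2), of p] dvd_prodI[OF finite_P that, of id] y[OF that]
      cong_trans by (auto intro: cong_trans)
  with a(1) show ?thesis using that by (simp add: cong_def)
qed

text \<open>If S contains an odd prime p, take a nonresidue modulo p that is 1 modulo 8 and modulo
  the other primes. Otherwise only \<open>chi4\<close> and \<open>chi8\<close> are involved and a
  residue modulo 8 decides.\<close>

lemma genus_characters_independent:
  assumes "S \<subseteq> {1, 2} \<union> P" "S \<noteq> {}"
  obtains a where "coprime a (8 * \<Prod>P)" "(\<Prod>i\<in>S. genus_character i a) = -1"
proof (cases "S \<inter> P = {}")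
  case False
  then obtain p where p: "p \<in> S" "p \<in> P" by blast
  obtain t where t: "Legendre (int t) (int p) = -1"
    using quadratic_nonresidue_exists odd_primes[OF p(2)] by blast
  obtain a where a: "a mod 8 = 1 mod 8" "\<And>r. r \<in> P \<Longrightarrow> [a = (if r = p then t else 1)] (mod r)"
    by (rule crt_8_prod[of 1 "\<lambda>r. if r = p then t else 1"]) blast
  have p12: "p \<noteq> 1" "p \<noteq> 2" using odd_primes[OF p(2)] by auto
  have ap: "genus_character p a = -1"
  proof -
    have "Legendre (int a) (int p) = Legendre (int t) (int p)"
      using a(2)[OF p(2)] by (intro Legendre_cong) (simp add: cong_int_iff)
    then show ?thesis using t p12 by (simp add: genus_character_def)
  qed
  have a1: "genus_character i a = 1" if "i \<in> S - {p}" for i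
  proof -
    have i: "i \<in> {1, 2} \<union> P" using that assms(1) by blast
    have "genus_character i a = genus_character i 1"
      using i a(1) a(2)[of i] that by (intro genus_character_cong) auto
    then show ?thesis using genus_character_one[OF i] by simp
  qed
  have "finite S" using finite_subset[OF assms(1)] finite_P by simp
  then have "(\<Prod>i\<in>S. genus_character i a) = genus_character p a * (\<Prod>i\<in>S - {p}. genus_character i a)"
    using p(1) by (rule prod.remove)
  also have "\<dots> = -1" using ap a1 by simp
  finally have 1: "(\<Prod>i\<in>S. genus_character i a) = -1" .
  have "\<not> r dvd a" if r: "r \<in> P" for r
  proof (cases "r = p")
    case True
    have "Legendre (int a) (int p) \<noteq> 0" using ap p12 by (simp add: genus_character_def)
    then show ?thesis using True Legendre_nonzero_iff odd_primes[OF p(2)] by blast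
  next
    case False
    then show ?thesis using a(2)[OF r] odd_primes[OF r] by (auto simp: cong_dvd_iff)
  qed
  moreover have "odd a" using a(1) by presburger
  ultimately have "coprime a (8 * \<Prod>P)" using coprime_8_prod_iff by blast
  with 1 show ?thesis using that by blast
next
  case True
  \<comment> \<open>At 5, \<open>chi4\<close> is 1 and \<open>chi8\<close> is -1, so the product is
    -1 whether or not 1 lies in S; at 3, \<open>chi4\<close> is -1, which serves S = {1}.\<close>
  define c :: nat where "c = (if 2 \<in> S then 5 else 3)"
  obtain a where a: "a mod 8 = c mod 8" "\<And>r. r \<in> P \<Longrightarrow> [a = 1] (mod r)"
    by (rule crt_8_prod[of c "\<lambda>r. 1"]) blast
  have "odd c" unfolding c_def by simp
  then have "odd a" using a(1) by presburger
  moreover have "\<not> r dvd a" if r: "r \<in> P" for r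
    using a(2)[OF r] odd_primes[OF r] by (auto simp: cong_dvd_iff)
  ultimately have cop: "coprime a (8 * \<Prod>P)" using coprime_8_prod_iff by blast
  have "chi4 a = chi4 c" "chi8 a = chi8 c"
    using chi4_mod[of a] chi4_mod[of c] chi8_mod[of a] chi8_mod[of c] a(1) by simp_all
  then have vals: "genus_character 1 a = (if 2 \<in> S then 1 else -1)" "genus_character 2 a = -1"
    unfolding c_def by (simp_all add: genus_character_def chi4_def chi8_def)
  have "S \<subseteq> {1, 2}" using True assms(1) by blast
  then have "S = {1} \<or> S = {2} \<or> S = {1, 2}" using assms(2) by blast
  then have "(\<Prod>i\<in>S. genus_character i a) = -1" using vals by auto
  with cop show ?thesis using that by blast
qed

lemma nonprincipal_genus_character:
  assumes S: "S \<subseteq> {1, 2} \<union> P" "S \<noteq> {}"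
  shows "nonprincipal_character (8 * \<Prod>P)
    (\<lambda>n. of_bool (coprime n (8 * \<Prod>P)) * (\<Prod>i\<in>S. real_of_int (genus_character i n)))"
    (is "nonprincipal_character ?N ?\<chi>")
proof
  show "?N > 0" using odd_primes by (auto intro!: prod_pos dest: prime_gt_0_nat)
  show "?\<chi> n = 0" if "\<not> coprime n ?N" for n using that by simp
  show "?\<chi> n = 1 \<or> ?\<chi> n = -1" if cop: "coprime n ?N" for n
  proof -
    have "finite S" using finite_subset[OF S(1)] finite_P by simp
    then have "(\<Prod>i\<in>S. genus_character i n) = 1 \<or> (\<Prod>i\<in>S. genus_character i n) = -1"
      using S(1)
    proof (induction S rule: finite_induct)
      case (insert i S)
      then show ?case using genus_character_unit[OF _ cop, of i] by auto
    qed simp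
    then show ?thesis using cop by (auto simp: of_int_prod[symmetric] simp del: of_int_prod)
  qed
  show "?\<chi> (m * n) = ?\<chi> m * ?\<chi> n" for m n
  proof -
    have "(\<Prod>i\<in>S. genus_character i (m * n)) = (\<Prod>i\<in>S. genus_character i m) * (\<Prod>i\<in>S. genus_character i n)"
      unfolding prod.distrib[symmetric] using S(1) by (intro prod.cong refl genus_character_mult) auto
    then show ?thesis
      by (simp add: of_int_prod[symmetric] coprime_mult_left_iff del: of_int_prod)
  qed
  show "?\<chi> (n + ?N) = ?\<chi> n" for n
  proof -
    have "coprime (n + ?N) ?N \<longleftrightarrow> coprime n ?N"
      by (simp only: coprime_iff_gcd_eq_1 gcd_add1)
    moreover have "genus_character i (n + ?N) = genus_character i n" if "i \<in> S" for i
    proof (rule genus_character_cong)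
      show "i \<in> {1, 2} \<union> P" using that S(1) by blast
      show "(n + ?N) mod 8 = n mod 8" by simp
      assume "i \<in> P"
      then have "i dvd ?N" using dvd_prodI[OF finite_P, of i id] by simp
      then obtain k where "?N = i * k" by blast
      then show "[n + ?N = n] (mod i)" by (simp only: cong_def mod_mult_self2)
    qed
    ultimately show ?thesis by simp
  qed
  obtain a where "coprime a ?N" "(\<Prod>i\<in>S. genus_character i a) = -1"
    by (rule genus_characters_independent[OF S])
  then have "?\<chi> a = -1" by (simp add: of_int_prod[symmetric] del: of_int_prod)
  then show "\<exists>a. ?\<chi> a = -1" by blast
qed

lemma odd_prime_with_genus:
  assumes \<epsilon>: "\<And>i. i \<in> {1, 2} \<union> P \<Longrightarrow> \<epsilon> i = 1 \<or> \<epsilon> i = -1"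
    and neg: "\<exists>i\<in>{1, 2} \<union> P. \<epsilon> i = -1"
  obtains q where "prime q" "coprime q (8 * \<Prod>P)"
    "\<And>i. i \<in> {1, 2} \<union> P \<Longrightarrow> genus_character i q = \<epsilon> i"
proof -
  have N: "8 * \<Prod>P > 0" using odd_primes by (auto intro!: prod_pos dest: prime_gt_0_nat)
  have fin: "finite ({1, 2} \<union> P)" using finite_P by simp
  have r: "real_of_int (\<epsilon> i) = 1 \<or> real_of_int (\<epsilon> i) = -1" if "i \<in> {1, 2} \<union> P" for i
    using \<epsilon>[OF that] by auto
  obtain p k where pk: "prime p" "k > 0" "coprime p (8 * \<Prod>P)"
      "\<And>i. i \<in> {1, 2} \<union> P \<Longrightarrow> real_of_int (genus_character i (p ^ k)) = real_of_int (\<epsilon> i)"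
    by (rule prime_power_with_character_values[OF fin N nonprincipal_genus_character r]) blast+
  have pow: "genus_character i p ^ k = \<epsilon> i" if "i \<in> {1, 2} \<union> P" for i
    using pk(4)[OF that] genus_character_power[OF that] by simp
  obtain j where j: "j \<in> {1, 2} \<union> P" "\<epsilon> j = -1" using neg by blast
  have "odd k"
  proof
    assume "even k"
    then have "0 \<le> genus_character j p ^ k" by (rule zero_le_even_power)
    then show False using pow[OF j(1)] j(2) by simp
  qed
  then have "genus_character i p = \<epsilon> i" if "i \<in> {1, 2} \<union> P" for i
    using pow[OF that] genus_character_unit[OF that pk(3)] by auto
  then show ?thesis using that pk by blast
qed

end

section \<open>The three-square theorem in the classes 1 and 2 modulo 4\<close>

lemma squarefree_odd_part:
  fixes m :: nat
  assumes "squarefree m" and P: "P = {p. prime p \<and> p dvd m \<and> odd p}"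
  shows "even m \<Longrightarrow> m = 2 * \<Prod>P" "odd m \<Longrightarrow> m = \<Prod>P"
proof -
  have m0: "m \<noteq> 0" using assms(1) by (metis not_squarefree_0)
  have "m = \<Prod>(prime_factors m)" using assms(1) by (rule squarefree_eq_prod_prime_factors)
  also have "prime_factors m = P \<union> (if even m then {2} else {})"
    using m0 unfolding P
    by (auto simp: in_prime_factors_iff dest: prime_odd_nat) (metis prime_ge_2_nat prime_odd_nat order_le_less)+
  also have "\<Prod>\<dots> = (if even m then 2 else 1) * \<Prod>P"
  proof -
    have "finite P" unfolding P using m0 by (auto intro: finite_subset[OF _ finite_divisors_nat])
    moreover have "2 \<notin> P" unfolding P by simp
    ultimately show ?thesis by simp
  qed
  finally have eq: "m = (if even m then 2 else 1) * \<Prod>P" .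
  show "m = 2 * \<Prod>P" if "even m" using eq[unfolded if_P[OF that]] .
  show "m = \<Prod>P" if "odd m" using eq[unfolded if_not_P[OF that] mult_1] .
qed

text \<open>Asking (q/p) = (-1/p) gives (-q/p) = 1 for each odd prime p dividing m. With q = 1 mod
  4, reciprocity turns this into (p/q) = (-1/p), so the odd part of m has symbol \<open>e\<close> at
  q. For even m the condition \<open>chi8 q = e\<close> makes (m/q) = e^2 = 1; for odd m already e =
  \<open>chi4 m\<close> = 1.\<close>

lemma three_squares_squarefree:
  fixes m :: nat
  assumes sf: "squarefree m" and m4: "m mod 4 = 1 \<or> m mod 4 = 2"
  shows "\<exists>a b c. int m = a^2 + b^2 + c^2"
proof -
  have m0: "m > 0" using m4 by (auto intro: Nat.gr0I)
  define P where "P = {p. prime p \<and> p dvd m \<and> odd p}"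
  have finP: "finite P" unfolding P_def using m0 by (auto intro: finite_subset[OF _ finite_divisors_nat])
  have P: "prime p \<and> 2 < p" if "p \<in> P" for p
    using that prime_ge_2_nat[of p] unfolding P_def by (cases "p = 2") auto
  note m = squarefree_odd_part[OF sf P_def]
  define e where "e = (\<Prod>p\<in>P. chi4 p)"
  have e_unit: "chi4 p = 1 \<or> chi4 p = -1" if "p \<in> P" for p
    using that unfolding P_def chi4_def by auto
  have e_pm: "(\<Prod>p\<in>T. chi4 p) = 1 \<or> (\<Prod>p\<in>T. chi4 p) = -1" if "finite T" "T \<subseteq> P" for T
    using that
  proof (induction T rule: finite_induct)
    case (insert p T)
    then show ?case using e_unit[of p] by auto
  qed simp
  have root_of_minus_q: "\<exists>\<rho>. int m dvd \<rho>^2 + int q"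
    if "\<And>p. p \<in> P \<Longrightarrow> Legendre (int q) (int p) = chi4 p" for q
  proof (rule square_mod_squarefree[OF sf])
    fix p assume p: "prime p" "p dvd m"
    show "\<exists>r. int p dvd r^2 + int q"
    proof (cases "p = 2")
      case True
      \<comment> \<open>At the prime 2, q itself serves as the root.\<close>
      have "even ((int q)^2 + int q)" by simp
      then show ?thesis using True by (intro exI[of _ "int q"]) simp
    next
      case False
      then have "p \<in> P" using p prime_odd_nat[of p] prime_ge_2_nat[of p] unfolding P_def by auto
      then have "Legendre (-1 * int q) (int p) = 1"
        using Legendre_mult[of p "-1" "int q"] Legendre_minus_1[of p] that[of p] P[of p] e_unit[of p] by auto
      from square_root_of_Legendre[OF this] show ?thesis by simp
    qed
  qed
  show ?thesis
  proof (cases "\<forall>p\<in>P. chi4 p = 1")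
    case True
    then have "\<exists>\<rho>. int m dvd \<rho>^2 + int 1"
      by (intro root_of_minus_q) (use P Legendre_1 in auto)
    then obtain \<rho> where "int m dvd \<rho>^2 + 1" by auto
    then show ?thesis using m0 by (intro three_squares_criterion[of "int m" 1 \<rho> 0 0]) auto
  next
    case False
    define \<epsilon> where "\<epsilon> = (\<lambda>i. if i = 1 then 1 else if i = 2 then e else chi4 i)"
    have "1 \<notin> P" "2 \<notin> P" using P by force+
    have \<epsilon>_unit: "\<epsilon> i = 1 \<or> \<epsilon> i = -1" if "i \<in> {1, 2} \<union> P" for i
      using that e_unit e_pm[OF finP order_refl] unfolding \<epsilon>_def e_def by auto
    have \<epsilon>_neg: "\<exists>i\<in>{1, 2} \<union> P. \<epsilon> i = -1"
    proof -
      obtain p where p: "p \<in> P" "chi4 p = -1" using False e_unit by blast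
      moreover have "\<epsilon> p = chi4 p" unfolding \<epsilon>_def using p \<open>1 \<notin> P\<close> \<open>2 \<notin> P\<close> by auto
      ultimately show ?thesis by auto
    qed
    obtain q where q: "prime q" "coprime q (8 * \<Prod>P)"
        "\<And>i. i \<in> {1, 2} \<union> P \<Longrightarrow> genus_character i q = \<epsilon> i"
      by (rule odd_prime_with_genus[OF finP P \<epsilon>_unit \<epsilon>_neg]) blast+
    have chi4q: "chi4 q = 1" and chi8q: "chi8 q = e"
      using q(3)[of 1] q(3)[of 2] unfolding \<epsilon>_def by (simp_all add: genus_character_def)
    have Lqp: "Legendre (int q) (int p) = chi4 p" if "p \<in> P" for p
    proof -
      have "p \<noteq> 1" "p \<noteq> 2" using P[OF that] by auto
      then show ?thesis using q(3)[of p] that unfolding \<epsilon>_def genus_character_def by simp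
    qed
    have q4: "q mod 4 = 1" using chi4q unfolding chi4_def by (auto split: if_splits)
    then have q2: "2 < q" using prime_ge_2_nat[OF q(1)] by (cases "q = 2") auto
    have cop: "coprime (int m) (int q)"
    proof -
      have "m dvd 8 * \<Prod>P"
      proof (cases "even m")
        case True
        have "8 * \<Prod>P = 2 * \<Prod>P * 4" by simp
        then show ?thesis using m(1)[OF True] by (metis dvd_triv_left)
      next
        case False
        then show ?thesis using m(2)[OF False] by (metis dvd_triv_right)
      qed
      then show ?thesis using q(2) by (metis coprime_commute coprime_divisors coprime_int_iff dvd_refl)
    qed
    obtain \<rho> where \<rho>: "int m dvd \<rho>^2 + int q" using root_of_minus_q[of q] Lqp by blast
    have "Legendre (int p) (int q) = chi4 p" if "p \<in> P" for p
    proof -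
      have "p \<noteq> q" using q(2) coprime_8_prod_iff[OF finP P, of q] that by auto
      then show ?thesis using Legendre_reciprocity_1_mod_4[of p q] P[OF that] q(1) q4 Lqp[OF that] by simp
    qed
    then have LP: "Legendre (int (\<Prod>P)) (int q) = e"
      using Legendre_prod[OF q(1) q2 finP, of int] unfolding e_def by simp
    have "Legendre (int m) (int q) = 1"
    proof (cases "even m")
      case True
      then have "int m = 2 * int (\<Prod>P)" using m(1) by (metis of_nat_mult of_nat_numeral)
      then have "Legendre (int m) (int q) = e * e"
        using Legendre_mult[OF q(1) q2, of 2 "int (\<Prod>P)"] Legendre_2[OF q(1) q4] chi8q LP by simp
      then show ?thesis using e_pm[OF finP order_refl] unfolding e_def by auto
    next
      case False
      then have mP: "m = \<Prod>P" by (rule m(2))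
      have "e = chi4 m" unfolding e_def mP using chi4_prod[OF finP, of "\<lambda>p. p"] by simp
      also have "\<dots> = 1" using m4 False unfolding chi4_def by presburger
      finally show ?thesis using LP mP by simp
    qed
    then obtain \<sigma> where \<sigma>: "int q dvd \<sigma>^2 - int m" using square_root_of_Legendre by blast
    have "Legendre (-1) (int q) = 1" using Legendre_minus_1[OF q(1) q2] chi4q by simp
    then obtain \<tau> where "int q dvd \<tau>^2 - (-1)" using square_root_of_Legendre by blast
    then have \<tau>: "int q dvd \<tau>^2 + 1" by simp
    show ?thesis using three_squares_criterion[OF _ _ cop \<rho> \<sigma> \<tau>] m0 q2 by simp
  qed
qed

text \<open>The square part k^2 has odd k, since otherwise 4 divides m; so k^2 = 1 mod 4, the
  squarefree part lies in the same class as m, and its representation is scaled by k.\<close>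

theorem three_squares:
  fixes m :: int
  assumes "m > 0" "m mod 4 = 1 \<or> m mod 4 = 2"
  shows "\<exists>a b c. m = a^2 + b^2 + c^2"
proof -
  define s where "s = squarefree_part (nat m)"
  define k where "k = square_part (nat m)"
  have "nat m = s * k^2" unfolding s_def k_def by (rule squarefree_decompose)
  then have mk: "m = int s * (int k)^2" using assms(1) by (metis int_nat_eq less_imp_le of_nat_mult of_nat_power)
  have "odd k"
  proof
    assume "even k"
    then have "4 dvd (int k)^2" by (auto elim!: evenE simp: power_mult_distrib)
    then have "m mod 4 = 0" unfolding mk by simp
    then show False using assms(2) by simp
  qed
  then have "int k mod 4 = 1 \<or> int k mod 4 = 3" by presburger
  moreover have "(int k)^2 mod 4 = (int k mod 4)^2 mod 4" by (simp add: power_mod)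
  ultimately have "(int k)^2 mod 4 = 1" by auto
  then have "m mod 4 = int s mod 4"
    unfolding mk by (metis mod_mult_right_eq mult.right_neutral)
  then have "s mod 4 = 1 \<or> s mod 4 = 2" using assms(2) by presburger
  then obtain a b c where "int s = a^2 + b^2 + c^2"
    using three_squares_squarefree[of s] unfolding s_def by auto
  then have "m = (a * int k)^2 + (b * int k)^2 + (c * int k)^2"
    unfolding mk by (simp add: power_mult_distrib algebra_simps)
  then show ?thesis by blast
qed

section \<open>The quaternary form\<close>

lemma gcd_one_of_last:
  fixes x y z w n :: int
  assumes "Q15_1 x y z w = n" "coprime w n"
  shows "Gcd {x, y, z, w} = 1"
proof -
  let ?g = "Gcd {x, y, z, w}"
  have g: "?g dvd x" "?g dvd y" "?g dvd z" "?g dvd w" by (rule Gcd_dvd; simp)+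
  then have "?g dvd Q15_1 x y z w"
    unfolding Q15_1_def by (intro dvd_add) (auto simp: power2_eq_square)
  with assms g(4) have "is_unit ?g" by (metis coprime_common_divisor)
  then show ?thesis by (metis Gcd_int_greater_eq_0 abs_of_nonneg zdvd1_eq)
qed

lemma square_mod_4: "(a::int)^2 mod 4 = (if even a then 0 else 1)"
proof -
  have "a mod 4 = 0 \<or> a mod 4 = 1 \<or> a mod 4 = 2 \<or> a mod 4 = 3" by presburger
  moreover have "a^2 mod 4 = (a mod 4)^2 mod 4" by (simp add: power_mod)
  moreover have "even a \<longleftrightarrow> a mod 4 = 0 \<or> a mod 4 = 2" by presburger
  ultimately show ?thesis by auto
qed

text \<open>For m = 1 mod 4 exactly one of the three squares is odd, for m = 2 exactly two are. So
  one entry has the parity of m and the other two agree, with a^2 + b^2 = 2((a+b)/2)^2 +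
  2((a-b)/2)^2. The parity of c is what makes c = 2z + w solvable for z.\<close>

lemma three_squares_two_equal_parity:
  fixes m :: int
  assumes "m > 0" "m mod 4 = 1 \<or> m mod 4 = 2"
  obtains x y c where "m = 2 * x^2 + 2 * y^2 + c^2" "even c \<longleftrightarrow> even m"
proof -
  note found = that
  obtain a b c where m: "m = a^2 + b^2 + c^2" using three_squares[OF assms] by blast
  have m4: "m mod 4 = (a^2 mod 4 + b^2 mod 4 + c^2 mod 4) mod 4"
    unfolding m by (intro mod_add_cong) simp_all
  have par: "even m \<longleftrightarrow> m mod 4 = 2" using assms(2) by presburger
  have res: thesis if e: "even a' \<longleftrightarrow> even b'" "even c' \<longleftrightarrow> even m" and m': "m = a'^2 + b'^2 + c'^2" for a' b' c' :: int
  proof -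
    obtain x where x: "a' + b' = 2 * x" using e(1) by (metis even_add evenE)
    obtain y where y: "a' - b' = 2 * y" using e(1) by (metis even_diff evenE even_add)
    have ab: "a' = x + y" "b' = x - y" using x y by auto
    have "m = 2 * x^2 + 2 * y^2 + c'^2"
      unfolding m' ab by (simp add: power2_eq_square algebra_simps)
    then show ?thesis using found e(2) by blast
  qed
  have "(even a \<longleftrightarrow> even b) \<and> (even c \<longleftrightarrow> even m) \<or> (even a \<longleftrightarrow> even c) \<and> (even b \<longleftrightarrow> even m)
      \<or> (even b \<longleftrightarrow> even c) \<and> (even a \<longleftrightarrow> even m)"
    using m4 assms(2) unfolding square_mod_4 par by (auto split: if_splits)
  then show ?thesis
    using res[of a b c] res[of a c b] res[of b c a] m by (auto simp: algebra_simps)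
qed

text \<open>These are the n for which 2n - 15 (n even) or 2(n - 30) (n odd) is not positive; all
  witnesses have w = 0.\<close>

lemma Q15_1_small:
  fixes n :: int
  assumes "0 < n" "n < 31" "odd n \<or> n < 8"
  shows "\<exists>x y z w. Q15_1 x y z w = n \<and> Gcd {x, y, z, w} = 1"
proof -
  have rep: ?thesis if "Q15_1 x y z 0 = n" "gcd x (gcd y z) = 1" for x y z
    using that by (intro exI[of _ x] exI[of _ y] exI[of _ z] exI[of _ 0]) simp
  have "n \<in> {1, 2, 3, 4, 5, 6, 7, 9, 11, 13, 15, 17, 19, 21, 23, 25, 27, 29}"
    using assms by simp presburger
  then show ?thesis
  proof (elim insertE emptyE)
    assume "n = 1"
    then show ?thesis by (intro rep[of 1 0 0]) (simp_all add: Q15_1_def gcd_non_0_int)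
  next
    assume "n = 2"
    then show ?thesis by (intro rep[of 1 1 0]) (simp_all add: Q15_1_def gcd_non_0_int)
  next
    assume "n = 3"
    then show ?thesis by (intro rep[of 1 0 1]) (simp_all add: Q15_1_def gcd_non_0_int)
  next
    assume "n = 4"
    then show ?thesis by (intro rep[of 1 1 1]) (simp_all add: Q15_1_def gcd_non_0_int)
  next
    assume "n = 5"
    then show ?thesis by (intro rep[of 2 1 0]) (simp_all add: Q15_1_def gcd_non_0_int)
  next
    assume "n = 6"
    then show ?thesis by (intro rep[of 2 0 1]) (simp_all add: Q15_1_def gcd_non_0_int)
  next
    assume "n = 7"
    then show ?thesis by (intro rep[of 2 1 1]) (simp_all add: Q15_1_def gcd_non_0_int)
  next
    assume "n = 9"
    then show ?thesis by (intro rep[of 1 0 2]) (simp_all add: Q15_1_def gcd_non_0_int)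
  next
    assume "n = 11"
    then show ?thesis by (intro rep[of 3 0 1]) (simp_all add: Q15_1_def gcd_non_0_int)
  next
    assume "n = 13"
    then show ?thesis by (intro rep[of 3 2 0]) (simp_all add: Q15_1_def gcd_non_0_int)
  next
    assume "n = 15"
    then show ?thesis by (intro rep[of 3 2 1]) (simp_all add: Q15_1_def gcd_non_0_int)
  next
    assume "n = 17"
    then show ?thesis by (intro rep[of 4 1 0]) (simp_all add: Q15_1_def gcd_non_0_int)
  next
    assume "n = 19"
    then show ?thesis by (intro rep[of 1 0 3]) (simp_all add: Q15_1_def gcd_non_0_int)
  next
    assume "n = 21"
    then show ?thesis by (intro rep[of 3 2 2]) (simp_all add: Q15_1_def gcd_non_0_int)
  next
    assume "n = 23"
    then show ?thesis by (intro rep[of 2 1 3]) (simp_all add: Q15_1_def gcd_non_0_int)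
  next
    assume "n = 25"
    then show ?thesis by (intro rep[of 4 3 0]) (simp_all add: Q15_1_def gcd_non_0_int)
  next
    assume "n = 27"
    then show ?thesis by (intro rep[of 5 0 1]) (simp_all add: Q15_1_def gcd_non_0_int)
  next
    assume "n = 29"
    then show ?thesis by (intro rep[of 5 2 0]) (simp_all add: Q15_1_def gcd_non_0_int)
  qed
qed

theorem theorem4p3: "primitively_universal Q15_1"
  unfolding primitively_universal_def
proof (intro allI impI)
  fix n :: int
  assume n: "n > 0"
  consider "n < 31" "odd n \<or> n < 8" | "even n" "n \<ge> 8" | "odd n" "n \<ge> 31" by linarith
  then show "\<exists>x y z w. Q15_1 x y z w = n \<and> Gcd {x, y, z, w} = 1"
  proof cases
    case 1
    then show ?thesis using Q15_1_small n by blast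
  next
    case 2
    have "(2 * n - 15) mod 4 = 1" using 2(1) by presburger
    then obtain x y c where xyc: "2 * n - 15 = 2 * x^2 + 2 * y^2 + c^2" "even c \<longleftrightarrow> even (2 * n - 15)"
      using three_squares_two_equal_parity[of "2 * n - 15"] 2(2) by auto
    from xyc(2) have "odd c" by simp
    then obtain z where z: "c = 2 * z + 1" by (rule oddE)
    have "2 * Q15_1 x y z 1 = 2 * n"
      using xyc(1) unfolding Q15_1_def z by (simp add: power2_eq_square algebra_simps)
    then have Q: "Q15_1 x y z 1 = n" by simp
    have "Gcd {x, y, z, 1} = 1" using gcd_one_of_last[OF Q] by simp
    with Q show ?thesis by blast
  next
    case 3
    have "(2 * (n - 30)) mod 4 = 2" using 3(1) by presburger
    then obtain x y c where xyc: "2 * (n - 30) = 2 * x^2 + 2 * y^2 + c^2" "even c \<longleftrightarrow> even (2 * (n - 30))"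
      using three_squares_two_equal_parity[of "2 * (n - 30)"] 3(2) by auto
    from xyc(2) have "even c" by simp
    then obtain t where t: "c = 2 * t" by (rule evenE)
    \<comment> \<open>Here c = 2z + w with w = 2, hence z = t - 1, and 15 w^2 = 60 accounts for n -
      30.\<close>
    have "2 * Q15_1 x y (t - 1) 2 = 2 * n"
      using xyc(1) unfolding Q15_1_def t by (simp add: power2_eq_square algebra_simps)
    then have Q: "Q15_1 x y (t - 1) 2 = n" by simp
    moreover have "coprime 2 n" using 3(1) by simp
    ultimately show ?thesis using gcd_one_of_last[OF Q] by blast
  qed
qed

end
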